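(* The polynomials $T_s(z)\in\mathbb{Z}[z]$ (with $T_0(z)=1$) satisfy, for every $s=1,2,\dots$, the Dwork-type congruence $$\frac{T_{s+1}(z)}{T_s(z^p)}\equiv\frac{T_s(z)}{T_{s-1}(z^p)}\pmod{p^s}.$$
   Context: Standing setup. Fix integers $k\ge 1$ and $n\ge 2k$, positive integers $r,q$ with $r/q\le 1/2$, and an odd prime $p$ of the form $p=\ell q+1$ with $\ell$ a positive integer. For $1\le i\le n-1$ put $v_i=i$ if $i<k$, $v_i=k$ if $k\le i\le n-k$, and $v_i=n-i$ if $i>n-k$. Let $x=(x_{i,j})$, $1\le i\le n-1$, $1\le j\le v_i$, be $k(n-k)$ variables and $z$ one more variable. Put $$\Delta(x)=\prod_{m=1}^{n-1}\ \prod_{1\le i<j\le v_m}(x_{m,j}-x_{m,i}),$$ and for $s\ge 1$ $$\bar\Phi_s(x,z)=\Big(\prod_{i=1}^{n-1}\prod_{j=1}^{v_i}x_{i,j}\Big)^{\frac{(p^s-1)(q-r)}{q}}\Delta(x)^{\frac{(p^s-1)(q-2r)}{q}}\Big(\prod_{i=1}^{n-2}\prod_{a=1}^{v_i}\prod_{b=1}^{v_{i+1}}(x_{i,a}-x_{i+1,b})\Big)^{\frac{(p^s-1)r}{q}}\Big(\prod_{i=1}^{k}(z-x_{k,i})(1-x_{n-k,i})\Big)^{\frac{(p^s-1)r}{q}},$$ $$\Phi_s(x,z)=\Delta(x)\,\bar\Phi_s(x,z)\in\mathbb{Z}[x,z].$$ For pairs $(i,j)$ put $e_{i,j}=|i-k|+2j-1$,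 and let $$N=k+\#\{(i,a,b):\ 1\le i\le n-2,\ 1\le a\le v_i,\ 1\le b\le v_{i+1},\ e_{i,a}<e_{i+1,b}\}.$$ For $s\ge1$ define $T_s(z)=(-1)^{\frac{(p^s-1)r}{q}N}$ times the coefficient (a polynomial in $z$) of the monomial $\prod_{i=1}^{n-1}\prod_{j=1}^{v_i}x_{i,j}^{\,jp^s-1}$ in $\Phi_s(x,z)$; and $T_0(z)=1$. One has $T_s(0)=1$, so quotients are understood as elements of $\mathbb{Z}[[z]]$, and the congruence is coefficientwise (equivalently, it is the cross-multiplied congruence of polynomials with integer coefficients). *)

theory Defs
  imports
    Complex_Main
    "HOL-Library.Poly_Mapping"
    "HOL-Computational_Algebra.Primes"
    "HOL-Computational_Algebra.Polynomial_FPS"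
    "HOL-Number_Theory.Cong"
begin

text \<open>
  \<open>\<int>[x, z]\<close> is represented as \<open>\<int>[z][x]\<close>: finitely supported maps from the monomials in the
  variables \<open>x\<^bsub>i,j\<^esub>\<close> (exponent vectors indexed by pairs) to coefficients in \<open>\<int>[z]\<close>. Multiplication
  of \<^typ>\<open>('a, 'b) poly_mapping\<close> is convolution, hence polynomial multiplication. The variables
  are indexed by all pairs of naturals, but only those with \<open>1 \<le> i \<le> n - 1\<close>, \<open>1 \<le> j \<le> v\<^sub>i\<close> are used.
\<close>

type_synonym monomial = "(nat \<times> nat) \<Rightarrow>\<^sub>0 nat"
type_synonym xz_poly = "monomial \<Rightarrow>\<^sub>0 int poly"

definition X :: "nat \<Rightarrow> nat \<Rightarrow> xz_poly" where
  "X i j = Poly_Mapping.single (Poly_Mapping.single (i, j) 1) 1"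

definition Z :: xz_poly where
  "Z = Poly_Mapping.single 0 [:0, 1:]"

definition vdim :: "nat \<Rightarrow> nat \<Rightarrow> nat \<Rightarrow> nat" where
  "vdim k n i = (if i < k then i else if i \<le> n - k then k else n - i)"

definition Delta :: "nat \<Rightarrow> nat \<Rightarrow> xz_poly" where
  "Delta k n = (\<Prod>m\<in>{1..n-1}. \<Prod>i\<in>{1..vdim k n m}. \<Prod>j\<in>{i<..vdim k n m}. X m j - X m i)"

text \<open>
  The divisions by \<open>q\<close> and the subtractions in the exponents below are exact
  when \<open>q dvd p - 1\<close> and \<open>2 * r \<le> q\<close>.
\<close>

definition Phi_bar :: "nat \<Rightarrow> nat \<Rightarrow> nat \<Rightarrow> nat \<Rightarrow> nat \<Rightarrow> nat \<Rightarrow> xz_poly" where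
  "Phi_bar k n r q p s =
     (\<Prod>i\<in>{1..n-1}. \<Prod>j\<in>{1..vdim k n i}. X i j) ^ ((p ^ s - 1) * (q - r) div q) *
     Delta k n ^ ((p ^ s - 1) * (q - 2 * r) div q) *
     (\<Prod>i\<in>{1..n-2}. \<Prod>a\<in>{1..vdim k n i}. \<Prod>b\<in>{1..vdim k n (i+1)}. X i a - X (i+1) b)
       ^ ((p ^ s - 1) * r div q) *
     (\<Prod>i\<in>{1..k}. (Z - X k i) * (1 - X (n-k) i)) ^ ((p ^ s - 1) * r div q)"

definition Phi :: "nat \<Rightarrow> nat \<Rightarrow> nat \<Rightarrow> nat \<Rightarrow> nat \<Rightarrow> nat \<Rightarrow> xz_poly" where
  "Phi k n r q p s = Delta k n * Phi_bar k n r q p s"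

definition e_wt :: "nat \<Rightarrow> nat \<Rightarrow> nat \<Rightarrow> int" where
  "e_wt k i j = \<bar>int i - int k\<bar> + 2 * int j - 1"

definition sign_count :: "nat \<Rightarrow> nat \<Rightarrow> nat" where
  "sign_count k n = k + card {(i, a, b). 1 \<le> i \<and> i \<le> n - 2 \<and>
     1 \<le> a \<and> a \<le> vdim k n i \<and> 1 \<le> b \<and> b \<le> vdim k n (i + 1) \<and>
     e_wt k i a < e_wt k (i + 1) b}"

definition target_monomial :: "nat \<Rightarrow> nat \<Rightarrow> nat \<Rightarrow> nat \<Rightarrow> monomial" where
  "target_monomial k n p s =
     (\<Sum>i\<in>{1..n-1}. \<Sum>j\<in>{1..vdim k n i}. Poly_Mapping.single (i, j) (j * p ^ s - 1))"

definition T_poly :: "nat \<Rightarrow> nat \<Rightarrow> nat \<Rightarrow> nat \<Rightarrow> nat \<Rightarrow> nat \<Rightarrow> int poly" where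
  "T_poly k n r q p s =
     (if s = 0 then 1
      else (- 1) ^ (((p ^ s - 1) * r div q) * sign_count k n) *
           Poly_Mapping.lookup (Phi k n r q p s) (target_monomial k n p s))"

definition subst_power :: "nat \<Rightarrow> int poly \<Rightarrow> int poly" where
  "subst_power m f = pcompose f (monom 1 m)"

text \<open>
  The quotient \<open>f / g\<close> in \<open>\<int>[[z]]\<close>. It is only meaningful if \<open>g\<close> has constant term 1;
  the last argument 1 of \<^term>\<open>fps_right_inverse\<close> is the inverse of that constant term.
\<close>

definition quot_fps :: "int poly \<Rightarrow> int poly \<Rightarrow> int fps" where
  "quot_fps f g = fps_of_poly f * fps_right_inverse (fps_of_poly g) 1"

definition fps_cong :: "int fps \<Rightarrow> int fps \<Rightarrow> int \<Rightarrow> bool" where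
  "fps_cong F G m \<longleftrightarrow> (\<forall>i. [fps_nth F i = fps_nth G i] (mod m))"

end

theory Submission
  imports Defs "HOL-Combinatorics.Transposition"
begin

text \<open>
  Up to sign \<open>\<Phi>\<^sub>s = \<Delta> G^[s]\<close> with \<open>G = \<Phi>-bar\<^sub>1\<close> and \<open>[s] = 1 + p + \<dots> + p^(s-1)\<close>, and \<open>T\<^sub>s\<close> is a coefficient of
  \<open>U^s (\<Delta> G^[s])\<close>, where \<open>U\<close> is the Cartier operator. This polynomial is alternating in each group of
  variables, and the degree of \<open>G\<close> in each variable is so small that it must be a multiple of \<open>\<Delta>\<close>;
  hence \<open>U^s (\<Delta> G^[s]) = T\<^sub>s \<Delta>\<close>. Let \<open>F\<close> be the Frobenius lift \<open>x \<mapsto> x^p, z \<mapsto> z^p\<close>. Define \<open>I\<^sub>t\<close> by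
  \<open>G^[s] = I\<^sub>1 F(G^[s-1]) + \<dots> + I\<^sub>s\<close>. Then \<open>p^(t-1)\<close> divides \<open>I\<^sub>t\<close> because \<open>F(G) \<equiv> G^p\<close> modulo \<open>p\<close>,
  and applying \<open>U^s\<close> to \<open>\<Delta>\<close> times this identity gives \<open>T\<^sub>s(z) = d\<^sub>1(z) T\<^bsub>s-1\<^esub>(z^p) + \<dots> + d\<^sub>s(z)\<close>
  with \<open>p^(t-1)\<close> dividing \<open>d\<^sub>t\<close>. The Dwork congruences follow from this recursion by induction.
  The value \<open>T\<^sub>s(0) = 1\<close> is the coefficient of a vertex of the Newton polytope at \<open>z = 0\<close>.
\<close>

section \<open>Congruences modulo powers of a prime\<close>

text \<open>Each further \<open>p\<close>-th power gains a factor \<open>p\<close>: in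
  \<open>c ^ p - d ^ p = (c - d) * S\<close> the cofactor \<open>S\<close> is congruent to
  \<open>p * d ^ (p - 1)\<close>, hence to 0, modulo \<open>p\<close>.\<close>

lemma dvd_power_prime_power_diff:
  fixes a b :: "'a::comm_ring_1"
  assumes "of_nat p dvd a - b"
  shows "of_nat p ^ Suc j dvd a ^ p ^ j - b ^ p ^ j"
proof (induction j)
  case 0
  then show ?case using assms by simp
next
  case (Suc j)
  define c d where "c = a ^ p ^ j" and "d = b ^ p ^ j"
  have cd: "of_nat p dvd c - d"
    using Suc dvd_mult_left unfolding c_def d_def by fastforce
  \<comment> \<open>Every one of the \<open>p\<close> summands of the cofactor is congruent to
    \<open>d ^ (p - 1)\<close>; the term added at the end compensates for subtracting it
    \<open>p\<close> times.\<close>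
  have "of_nat p dvd (\<Sum>i<p. c ^ i * d ^ (p - Suc i) - d ^ (p - 1)) + of_nat p * d ^ (p - 1)"
  proof (intro dvd_add dvd_sum)
    fix i assume "i \<in> {..<p}"
    then have "c ^ i * d ^ (p - Suc i) - d ^ (p - 1) = (c ^ i - d ^ i) * d ^ (p - Suc i)"
      by (simp add: algebra_simps flip: power_add)
    moreover have "c - d dvd c ^ i - d ^ i"
      by (metis dvd_triv_left power_diff_sumr2)
    ultimately show "of_nat p dvd c ^ i * d ^ (p - Suc i) - d ^ (p - 1)"
      using cd by (metis dvd_mult2 dvd_trans)
  qed simp
  then have "of_nat p dvd (\<Sum>i<p. c ^ i * d ^ (p - Suc i))"
    by (simp add: sum_subtractf)
  then have "of_nat p dvd (\<Sum>i<p. d ^ (p - Suc i) * c ^ i)"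
    by (simp add: mult.commute)
  then have "of_nat p ^ Suc j * of_nat p dvd (c - d) * (\<Sum>i<p. d ^ (p - Suc i) * c ^ i)"
    using Suc by (intro mult_dvd_mono) (auto simp: c_def d_def)
  also have "\<dots> = c ^ p - d ^ p" by (simp add: power_diff_sumr2)
  finally show ?case by (simp add: c_def d_def mult_ac flip: power_mult)
qed

text \<open>The additivity of Frobenius modulo \<open>p\<close>, iterated \<open>t\<close> times;
  the inner binomial coefficients of a \<open>p\<close>-th power are multiples of
  \<open>p\<close>.\<close>

lemma dvd_prime_power_add:
  fixes a b :: "'a::comm_ring_1"
  assumes "prime p"
  shows "of_nat p dvd (a + b) ^ p ^ t - (a ^ p ^ t + b ^ p ^ t)"
proof (induction t)
  case (Suc t)
  have frob: "of_nat p dvd (c + d) ^ p - (c ^ p + d ^ p)" for c d :: 'a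
  proof -
    have p: "p > 0" using assms by (simp add: prime_gt_0_nat)
    have "(c + d) ^ p = (\<Sum>k\<le>p. of_nat (p choose k) * c ^ k * d ^ (p - k))"
      by (rule binomial_ring)
    also have "{..p} = insert 0 (insert p {0<..<p})" using p by auto
    also have "(\<Sum>k\<in>\<dots>. of_nat (p choose k) * c ^ k * d ^ (p - k))
      = d ^ p + (c ^ p + (\<Sum>k\<in>{0<..<p}. of_nat (p choose k) * c ^ k * d ^ (p - k)))"
      using p by simp
    finally have "(c + d) ^ p - (c ^ p + d ^ p)
      = (\<Sum>k\<in>{0<..<p}. of_nat (p choose k) * c ^ k * d ^ (p - k))" by simp
    moreover have "of_nat p dvd (of_nat (p choose k) :: 'a)" if "k \<in> {0<..<p}" for k
    proof -
      \<comment> \<open>Absorption turns \<open>k * (p choose k)\<close> into \<open>p\<close> times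
        a smaller binomial coefficient, and \<open>p\<close> cannot divide \<open>k\<close> because
        \<open>0 < k < p\<close>.\<close>
      have "p dvd k * (p choose k)"
        using times_binomial_minus1_eq[of k p] that by simp
      moreover have "\<not> p dvd k"
        using that by (auto dest: dvd_imp_le)
      ultimately have "p dvd (p choose k)"
        using assms prime_dvd_mult_iff by blast
      then show ?thesis by (metis of_nat_dvd_iff dvdE dvdI of_nat_mult)
    qed
    ultimately show ?thesis by (auto intro!: dvd_sum)
  qed
  have "of_nat p dvd ((a + b) ^ p ^ t) ^ p - (a ^ p ^ t + b ^ p ^ t) ^ p"
    using Suc by (metis dvd_trans dvd_triv_left power_diff_sumr2)
  from dvd_add[OF this frob[of "a ^ p ^ t" "b ^ p ^ t"]]
  have "of_nat p dvd ((a + b) ^ p ^ t) ^ p - ((a ^ p ^ t) ^ p + (b ^ p ^ t) ^ p)"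
    by (simp add: algebra_simps)
  then show ?case by (simp only: power_Suc2 power_mult)
qed simp

section \<open>Repunits and ghost terms\<close>

text \<open>The exponent \<open>[s]\<close> of the overview, i.e.
  \<open>(p ^ s - 1) div (p - 1)\<close> for \<open>p > 1\<close>; see
  \<open>repunit_mult\<close>.\<close>

definition repunit :: "nat \<Rightarrow> nat \<Rightarrow> nat" where
  "repunit p s = (\<Sum>i<s. p ^ i)"

lemma repunit_0 [simp]: "repunit p 0 = 0" by (simp add: repunit_def)

lemma repunit_Suc: "repunit p (Suc s) = repunit p s + p ^ s" by (simp add: repunit_def)

lemma repunit_add: "repunit p (s + t) = repunit p s + p ^ s * repunit p t"
  by (induction t) (simp_all add: repunit_Suc algebra_simps power_add)

lemma repunit_mult: "p \<ge> 1 \<Longrightarrow> repunit p s * (p - 1) = p ^ s - 1"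
proof (induction s)
  case (Suc s)
  have "p ^ s \<ge> 1" using Suc by simp
  with Suc show ?case by (simp add: repunit_Suc algebra_simps diff_mult_distrib2)
qed simp

text \<open>
  The recursion solves \<open>g ^ repunit p s = (\<Sum>t=1..s. ghost t * F t (g ^ repunit p (s - t)))\<close>, where \<open>F t\<close> is the
  \<open>t\<close>-th power of a lift of Frobenius.
\<close>

fun ghost :: "(nat \<Rightarrow> 'a \<Rightarrow> 'a) \<Rightarrow> nat \<Rightarrow> 'a \<Rightarrow> nat \<Rightarrow> 'a::comm_ring_1" where
  "ghost F p g s = g ^ repunit p s - (\<Sum>t\<in>{1..<s}. ghost F p g t * F t (g ^ repunit p (s - t)))"

declare ghost.simps [simp del]

lemma power_repunit_eq_sum_ghost:
  assumes "F s 1 = 1" and "s > 0"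
  shows "g ^ repunit p s = (\<Sum>t\<in>{1..s}. ghost F p g t * F t (g ^ repunit p (s - t)))"
proof -
  have "{1..s} = insert s {1..<s}" using assms(2) by auto
  then show ?thesis using assms by (simp add: ghost.simps[of F p g s])
qed

text \<open>Writing \<open>g ^ repunit p s\<close> as \<open>g ^ repunit p s'\<close> times
  \<open>g ^ p ^ s'\<close> and expanding the first factor by the identity for
  \<open>s' = s - 1\<close>, the two sums match term by term. Term \<open>t\<close> acquires the
  factor \<open>g ^ p ^ s' - F t g ^ p ^ (s' - t)\<close>, which supplies
  \<open>p ^ (s' - t + 1)\<close>, while the earlier ghost term supplies
  \<open>p ^ (t - 1)\<close>.\<close>

lemma dvd_ghost:
  fixes g :: "'a::comm_ring_1"
  assumes mult: "\<And>t a b. F t (a * b) = F t a * F t b" and one: "\<And>t. F t 1 = 1"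
    and frob: "\<And>t. of_nat p dvd F t g - g ^ p ^ t"
  shows "of_nat p ^ (s - 1) dvd ghost F p g s"
proof (induction s rule: less_induct)
  case (less s)
  show ?case
  proof (cases "s \<le> 1")
    case False
    define s' where "s' = s - 1"
    have s': "s = Suc s'" "s' > 0" using False by (auto simp: s'_def)
    have F_power: "F t (a ^ m) = F t a ^ m" for t a m
      by (induction m) (simp_all add: one mult)
    have "ghost F p g s = g ^ repunit p s' * g ^ p ^ s'
        - (\<Sum>t\<in>{1..s'}. ghost F p g t * F t (g ^ repunit p (s - t)))"
      unfolding ghost.simps[of F p g s] using s' by (simp add: repunit_Suc power_add atLeastLessThanSuc_atLeastAtMost)
    also have "g ^ repunit p s' = (\<Sum>t\<in>{1..s'}. ghost F p g t * F t (g ^ repunit p (s' - t)))"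
      using s' one by (intro power_repunit_eq_sum_ghost) auto
    also have "(\<Sum>t\<in>{1..s'}. ghost F p g t * F t (g ^ repunit p (s - t)))
        = (\<Sum>t\<in>{1..s'}. ghost F p g t * F t (g ^ repunit p (s' - t)) * F t g ^ p ^ (s' - t))"
      by (intro sum.cong) (auto simp: s' Suc_diff_le repunit_Suc power_add mult F_power)
    finally have eq: "ghost F p g s = (\<Sum>t\<in>{1..s'}. ghost F p g t *
        (F t (g ^ repunit p (s' - t)) * (g ^ p ^ s' - F t g ^ p ^ (s' - t))))"
      by (simp add: sum_distrib_left right_diff_distrib mult_ac sum_subtractf)
    show ?thesis
      unfolding eq
    proof (rule dvd_sum)
      fix t assume t: "t \<in> {1..s'}"
      have "of_nat p ^ Suc (s' - t) dvd (g ^ p ^ t) ^ p ^ (s' - t) - F t g ^ p ^ (s' - t)"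
        by (rule dvd_power_prime_power_diff) (metis frob dvd_minus_iff minus_diff_eq)
      moreover have "(g ^ p ^ t) ^ p ^ (s' - t) = g ^ p ^ s'"
        using t by (simp flip: power_mult power_add)
      moreover have "of_nat p ^ (t - 1) dvd ghost F p g t"
        using t s' by (intro less) auto
      ultimately have "of_nat p ^ (t - 1) * of_nat p ^ Suc (s' - t) dvd ghost F p g t *
        (F t (g ^ repunit p (s' - t)) * (g ^ p ^ s' - F t g ^ p ^ (s' - t)))"
        by (intro mult_dvd_mono) (auto simp: dvd_mult)
      moreover have "(of_nat p :: 'a) ^ (t - 1) * of_nat p ^ Suc (s' - t) = of_nat p ^ (s - 1)"
        unfolding power_add[symmetric] using t s' by simp
      ultimately show "of_nat p ^ (s - 1) dvd ghost F p g t *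
        (F t (g ^ repunit p (s' - t)) * (g ^ p ^ s' - F t g ^ p ^ (s' - t)))"
        by simp
    qed
  qed simp
qed

lemma dvd_unit_cancel_right:
  fixes a u :: "'a::comm_ring_1"
  assumes "m dvd a * u" and "u dvd 1"
  shows "m dvd a"
proof -
  obtain v where "u * v = 1" using assms(2) by (auto elim: dvdE)
  then have "a = a * u * v" by (simp add: mult.assoc)
  then show ?thesis using assms(1) by (metis dvd_mult2)
qed

text \<open>
  \<open>u s j\<close> stands for \<open>T\<^sub>s(z^(p^j))\<close>. The terms of the recursion for \<open>t \<ge> 2\<close> are handled by
  chaining the congruences already known for smaller \<open>s\<close>.
\<close>

lemma dwork_congruence:
  fixes u d :: "nat \<Rightarrow> nat \<Rightarrow> 'a::comm_ring_1"
  assumes unit: "\<And>s j. u s j dvd 1"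
    and rec: "\<And>s j. s > 0 \<Longrightarrow> u s j = (\<Sum>t\<in>{1..s}. d t j * u (s - t) (j + t))"
    and dvd: "\<And>t j. P ^ (t - 1) dvd d t j"
  shows "s > 0 \<Longrightarrow> P ^ s dvd u (s + 1) j * u (s - 1) (j + 1) - u s j * u s (j + 1)"
proof (induction s arbitrary: j rule: less_induct)
  case (less s)
  \<comment> \<open>In terms of quotients: \<open>u s j / u (s - 1) j\<close> agrees with the same
    quotient with index lowered by \<open>i\<close> and shift raised by \<open>i\<close>, modulo
    \<open>P ^ (s - i)\<close>. It composes the induction hypotheses for \<open>s - 1\<close>, ...,
    \<open>s - i\<close>.\<close>
  have chain: "i < s \<Longrightarrow> P ^ (s - i) dvd u s j * u (s - 1 - i) (j + i) - u (s - 1) j * u (s - i) (j + i)"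
    for i j
  proof (induction i)
    case (Suc i)
    let ?a = "u s j" and ?b = "u (s - 1) j" and ?c = "u (s - 1 - i) (j + i)" and ?e = "u (s - i) (j + i)"
    let ?x = "u (s - 2 - i) (j + i + 1)" and ?y = "u (s - 1 - i) (j + i + 1)"
    have "P ^ (s - 1 - i) dvd P ^ (s - i)" by (intro le_imp_power_dvd) auto
    then have 1: "P ^ (s - 1 - i) dvd ?a * ?c - ?b * ?e" using Suc dvd_trans by fastforce
    have "P ^ (s - 1 - i) dvd u (s - 1 - i + 1) (j + i) * u (s - 1 - i - 1) (j + i + 1) - ?c * ?y"
      using Suc.prems by (intro less.IH) auto
    then have 2: "P ^ (s - 1 - i) dvd ?e * ?x - ?c * ?y"
      using Suc.prems by (simp add: Suc_diff_Suc numeral_2_eq_2)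
    have "P ^ (s - 1 - i) dvd (?a * ?c - ?b * ?e) * ?x + ?b * (?e * ?x - ?c * ?y)"
      using 1 2 by simp
    \<comment> \<open>The terms with \<open>?e\<close> cancel, and what remains is a multiple of the
      unit \<open>?c\<close>.\<close>
    also have "(?a * ?c - ?b * ?e) * ?x + ?b * (?e * ?x - ?c * ?y) = (?a * ?x - ?b * ?y) * ?c"
      by (simp add: algebra_simps)
    finally have "P ^ (s - 1 - i) dvd ?a * ?x - ?b * ?y"
      using unit by (rule dvd_unit_cancel_right)
    then show ?case by (simp add: numeral_2_eq_2)
  qed simp
  let ?A = "u (s - 1) (j + 1)" and ?B = "u s (j + 1)"
  \<comment> \<open>The recursion for \<open>s + 1\<close> has one term more than that for
    \<open>s\<close>, namely \<open>t = s + 1\<close>; its coefficient is divisible by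
    \<open>P ^ s\<close> already. All other terms are compared pairwise.\<close>
  have "u (s + 1) j = (\<Sum>t\<in>{1..s}. d t j * u (s + 1 - t) (j + t)) + d (s + 1) j * u 0 (j + (s + 1))"
    by (subst rec) simp_all
  moreover have "u s j = (\<Sum>t\<in>{1..s}. d t j * u (s - t) (j + t))"
    using less.prems by (rule rec)
  ultimately have eq: "u (s + 1) j * ?A - u s j * ?B
      = (\<Sum>t\<in>{1..s}. d t j * (u (s + 1 - t) (j + t) * ?A - u (s - t) (j + t) * ?B))
        + d (s + 1) j * (u 0 (j + (s + 1)) * ?A)"
    by (simp add: sum_distrib_right sum_distrib_left algebra_simps sum_subtractf)
  show ?case
    unfolding eq
  proof (intro dvd_add dvd_sum)
    fix t assume t: "t \<in> {1..s}"
    \<comment> \<open>The chain of length \<open>t - 1\<close>, started at shift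
      \<open>j + 1\<close>, loses exactly the factor \<open>P ^ (t - 1)\<close> that
      \<open>d t j\<close> contributes.\<close>
    have "P ^ (s - (t - 1)) dvd
        ?B * u (s - 1 - (t - 1)) (j + 1 + (t - 1)) - ?A * u (s - (t - 1)) (j + 1 + (t - 1))"
      using t by (intro chain) auto
    moreover have "j + 1 + (t - 1) = j + t" "s - (t - 1) = s + 1 - t" "s - 1 - (t - 1) = s - t"
      using t by auto
    ultimately have "P ^ (s + 1 - t) dvd u (s + 1 - t) (j + t) * ?A - u (s - t) (j + t) * ?B"
      by (metis dvd_minus_iff minus_diff_eq mult.commute)
    with dvd[of t j] have "P ^ (t - 1) * P ^ (s + 1 - t) dvd
        d t j * (u (s + 1 - t) (j + t) * ?A - u (s - t) (j + t) * ?B)"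
      by (intro mult_dvd_mono)
    moreover have "P ^ (t - 1) * P ^ (s + 1 - t) = P ^ s"
      using t by (simp flip: power_add)
    ultimately show "P ^ s dvd d t j * (u (s + 1 - t) (j + t) * ?A - u (s - t) (j + t) * ?B)"
      by simp
  next
    show "P ^ s dvd d (s + 1) j * (u 0 (j + (s + 1)) * ?A)"
      using dvd[of "s + 1" j] by simp
  qed
qed

section \<open>Monomial substitutions and the Cartier operator\<close>

abbreviation "lookup \<equiv> Poly_Mapping.lookup"
abbreviation "single \<equiv> Poly_Mapping.single"
abbreviation "keys \<equiv> Poly_Mapping.keys"

text \<open>Additive identities between polynomials only have to be checked on single terms; most
  laws for substitutions and for the Cartier operator are proved this way.\<close>

lemma poly_mapping_add_induct [case_names single add]:
  assumes single: "\<And>k c. R (single k c)" and add: "\<And>P Q. R P \<Longrightarrow> R Q \<Longrightarrow> R (P + Q)"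
  shows "R P"
proof (induction P rule: Poly_Mapping.update_induct)
  case const
  show ?case using single[of undefined 0] by simp
next
  case (update P k c)
  have "Poly_Mapping.update k c P = P + single k c"
    using update(1) by (intro poly_mapping_eqI) (auto simp: lookup_update lookup_add lookup_single in_keys_iff when_def)
  then show ?case using add[OF update(3) single] by simp
qed

text \<open>One construction covers the Frobenius lift, the evaluation at \<open>z = 0\<close> and
  the permutations of variables: each acts separately on exponents and on coefficients.\<close>

definition subst_hom :: "('a \<Rightarrow> 'b) \<Rightarrow> ('c \<Rightarrow> 'd) \<Rightarrow> ('a \<Rightarrow>\<^sub>0 'c::zero) \<Rightarrow> ('b \<Rightarrow>\<^sub>0 'd::comm_monoid_add)" where
  "subst_hom \<mu> h P = (\<Sum>k\<in>keys P. single (\<mu> k) (h (lookup P k)))"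

locale monomial_hom =
  fixes \<mu> :: "'a::comm_monoid_add \<Rightarrow> 'b::comm_monoid_add"
    and h :: "'c::comm_ring_1 \<Rightarrow> 'd::comm_ring_1"
  assumes \<mu>_0 [simp]: "\<mu> 0 = 0" and \<mu>_add: "\<mu> (k + l) = \<mu> k + \<mu> l"
    and h_1 [simp]: "h 1 = 1" and h_add: "h (a + b) = h a + h b" and h_mult: "h (a * b) = h a * h b"
begin

lemma h_0 [simp]: "h 0 = 0"
  using h_add[of 0 0] by simp

abbreviation "H \<equiv> subst_hom \<mu> h"

lemma hom_single [simp]: "H (single k c) = single (\<mu> k) (h c)"
  by (cases "c = 0") (simp_all add: subst_hom_def)

lemma hom_alt:
  assumes "finite K" and "keys P \<subseteq> K"
  shows "H P = (\<Sum>k\<in>K. single (\<mu> k) (h (lookup P k)))"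
  unfolding subst_hom_def by (rule sum.mono_neutral_left) (use assms in \<open>auto simp: in_keys_iff\<close>)

lemma hom_add: "H (P + Q) = H P + H Q"
proof -
  let ?K = "keys P \<union> keys Q"
  have "H P = (\<Sum>k\<in>?K. single (\<mu> k) (h (lookup P k)))" "H Q = (\<Sum>k\<in>?K. single (\<mu> k) (h (lookup Q k)))"
    by (auto intro!: hom_alt)
  moreover have "H (P + Q) = (\<Sum>k\<in>?K. single (\<mu> k) (h (lookup (P + Q) k)))"
    using Poly_Mapping.keys_add[of P Q] by (intro hom_alt) auto
  ultimately show ?thesis by (simp add: lookup_add h_add single_add sum.distrib)
qed

lemma hom_0 [simp]: "H 0 = 0"
  by (simp add: subst_hom_def)

lemma hom_1 [simp]: "H 1 = 1"
  using hom_single[of 0 1] by simp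

lemma hom_mult: "H (P * Q) = H P * H Q"
proof (induction P rule: poly_mapping_add_induct)
  case (single k c)
  show ?case
    by (induction Q rule: poly_mapping_add_induct)
      (simp_all add: mult_single \<mu>_add h_mult distrib_left hom_add)
qed (simp add: distrib_right hom_add)

lemma hom_sum: "H (\<Sum>i\<in>I. f i) = (\<Sum>i\<in>I. H (f i))"
  by (induction I rule: infinite_finite_induct) (simp_all add: hom_add)

lemma hom_diff: "H (P - Q) = H P - H Q"
  using hom_add[of "P - Q" Q] by (simp add: algebra_simps)

lemma hom_uminus: "H (- P) = - H P"
  using hom_diff[of 0 P] by simp

lemma hom_power: "H (P ^ n) = H P ^ n"
  by (induction n) (simp_all add: hom_mult)

lemma hom_prod: "H (\<Prod>i\<in>I. f i) = (\<Prod>i\<in>I. H (f i))"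
  by (induction I rule: infinite_finite_induct) (simp_all add: hom_mult)

lemma lookup_hom_inj:
  assumes "inj \<mu>"
  shows "lookup (H P) (\<mu> k) = h (lookup P k)"
  by (induction P rule: poly_mapping_add_induct)
    (use assms in \<open>auto simp: lookup_single lookup_add hom_add h_add when_def inj_eq\<close>)

lemma keys_hom: "keys (H P) \<subseteq> \<mu> ` keys P"
  unfolding subst_hom_def using Poly_Mapping.keys_sum[of "\<lambda>k. single (\<mu> k) (h (lookup P k))" "keys P"]
  by (auto split: if_splits)

end

section \<open>Substitution of a power of z, scaling of exponents\<close>

lemma subst_power_hom:
  "subst_power e 1 = 1" "subst_power e (f + g) = subst_power e f + subst_power e g"
  "subst_power e (f * g) = subst_power e f * subst_power e g"
  by (simp_all add: subst_power_def pcompose_add pcompose_mult one_pCons)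

lemma subst_power_subst_power: "subst_power a (subst_power b f) = subst_power (a * b) f"
proof -
  have "pcompose (f ^ n) g = pcompose f g ^ n" for f g :: "int poly" and n
    by (induction n) (simp_all add: pcompose_mult one_pCons)
  then have "pcompose (monom 1 b) (monom 1 a :: int poly) = monom 1 (a * b)"
    by (simp add: monom_altdef pcompose_pCons flip: power_mult)
  then show ?thesis by (simp add: subst_power_def flip: pcompose_assoc)
qed

lemma subst_power_1: "subst_power (Suc 0) f = f"
  by (simp add: subst_power_def monom_altdef)

lemma poly_subst_power_0: "e > 0 \<Longrightarrow> poly (subst_power e f) 0 = poly f 0"
  by (simp add: subst_power_def poly_pcompose poly_monom zero_power)

definition scale_monom :: "nat \<Rightarrow> ('v \<Rightarrow>\<^sub>0 nat) \<Rightarrow> ('v \<Rightarrow>\<^sub>0 nat)" where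
  "scale_monom e = Poly_Mapping.map ((*) e)"

lemma lookup_scale_monom [simp]: "lookup (scale_monom e k) x = e * lookup k x"
  unfolding scale_monom_def by transfer (simp add: when_def)

lemma scale_monom_0 [simp]: "scale_monom e 0 = 0"
  by (rule poly_mapping_eqI) simp

lemma scale_monom_add: "scale_monom e (k + l) = scale_monom e k + scale_monom e l"
  by (rule poly_mapping_eqI) (simp add: lookup_add algebra_simps)

lemma scale_monom_Suc: "scale_monom (Suc e) k = k + scale_monom e k"
  by (rule poly_mapping_eqI) (simp add: lookup_add)

lemma scale_monom_zero_left [simp]: "scale_monom 0 k = 0"
  by (rule poly_mapping_eqI) simp

lemma scale_monom_Suc_0: "scale_monom (Suc 0) k = k"
  by (rule poly_mapping_eqI) simp

lemma scale_monom_single: "scale_monom e (single x a) = single x (e * a)"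
  by (rule poly_mapping_eqI) (simp add: lookup_single when_def)

text \<open>The powers for \<open>x\<close> and \<open>z\<close> are kept apart:
  \<open>frob e e\<close> is the Frobenius lift, and the Cartier operator, which acts on
  \<open>x\<close> alone, turns it into \<open>frob 1 e\<close>.\<close>

abbreviation frob :: "nat \<Rightarrow> nat \<Rightarrow> (('v \<Rightarrow>\<^sub>0 nat) \<Rightarrow>\<^sub>0 int poly) \<Rightarrow> (('v \<Rightarrow>\<^sub>0 nat) \<Rightarrow>\<^sub>0 int poly)" where
  "frob a b \<equiv> subst_hom (scale_monom a) (subst_power b)"

text \<open>\<open>scale_monom 1\<close> is the identity on exponents, as
  \<open>subst_power (Suc 0)\<close> in \<open>permute_vars\<close> is on coefficients; in this form
  both maps are instances of \<open>monomial_hom\<close>.\<close>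

abbreviation at_zero :: "(('v \<Rightarrow>\<^sub>0 nat) \<Rightarrow>\<^sub>0 int poly) \<Rightarrow> (('v \<Rightarrow>\<^sub>0 nat) \<Rightarrow>\<^sub>0 int)" where
  "at_zero \<equiv> subst_hom (scale_monom 1) (\<lambda>f. poly f 0)"

definition permute_monom :: "('v \<Rightarrow> 'v) \<Rightarrow> ('v \<Rightarrow>\<^sub>0 nat) \<Rightarrow> ('v \<Rightarrow>\<^sub>0 nat)" where
  "permute_monom \<tau> = Poly_Mapping.map_key \<tau>"

abbreviation permute_vars ::
  "('v \<Rightarrow> 'v) \<Rightarrow> (('v \<Rightarrow>\<^sub>0 nat) \<Rightarrow>\<^sub>0 int poly) \<Rightarrow> (('v \<Rightarrow>\<^sub>0 nat) \<Rightarrow>\<^sub>0 int poly)" where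
  "permute_vars \<tau> \<equiv> subst_hom (permute_monom \<tau>) (subst_power (Suc 0))"

lemma lookup_permute_monom [simp]: "inj \<tau> \<Longrightarrow> lookup (permute_monom \<tau> k) x = lookup k (\<tau> x)"
  by (simp add: permute_monom_def Poly_Mapping.map_key.rep_eq)

interpretation frob: monomial_hom "scale_monom a" "subst_power b" for a b
  by unfold_locales (simp_all add: subst_power_hom scale_monom_add)

interpretation at_zero: monomial_hom "scale_monom a" "\<lambda>f :: int poly. poly f 0" for a
  by unfold_locales (simp_all add: scale_monom_add)

lemma permute_vars_hom: "inj \<tau> \<Longrightarrow> monomial_hom (permute_monom \<tau>) (subst_power b)"
  by unfold_locales (auto intro!: poly_mapping_eqI simp: lookup_add subst_power_hom)

lemma lookup_frob_1: "lookup (frob 1 e P) k = subst_power e (lookup P k)"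
  using frob.lookup_hom_inj[of 1 e P k] by (simp add: inj_def scale_monom_Suc_0)

lemma lookup_at_zero: "lookup (at_zero P) k = poly (lookup P k) 0"
  using at_zero.lookup_hom_inj[of 1 P k] by (simp add: inj_def scale_monom_Suc_0)

text \<open>
  The Cartier operator: it sends \<open>x^(e k + e - 1)\<close> to \<open>x^k\<close> and kills all other monomials, where \<open>e - 1\<close>
  is added to the exponents of the variables in \<open>V\<close> only.
\<close>

definition cartier_monom :: "'v set \<Rightarrow> nat \<Rightarrow> ('v \<Rightarrow>\<^sub>0 nat) \<Rightarrow> ('v \<Rightarrow>\<^sub>0 nat)" where
  "cartier_monom V e k = scale_monom e k + (\<Sum>x\<in>V. single x (e - 1))"

definition cartier :: "'v set \<Rightarrow> nat \<Rightarrow> (('v \<Rightarrow>\<^sub>0 nat) \<Rightarrow>\<^sub>0 'c::comm_ring_1) \<Rightarrow> (('v \<Rightarrow>\<^sub>0 nat) \<Rightarrow>\<^sub>0 'c)" where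
  "cartier V e = Poly_Mapping.map_key (cartier_monom V e)"

lemma lookup_cartier_monom:
  "finite V \<Longrightarrow> lookup (cartier_monom V e k) x = e * lookup k x + (if x \<in> V then e - 1 else 0)"
  by (simp add: cartier_monom_def lookup_add lookup_sum lookup_single when_def)

context
  fixes V :: "'v set" and e :: nat
  assumes V: "finite V" and e: "e > 0"
begin

lemma inj_cartier_monom: "inj (cartier_monom V e)"
proof (rule injI, rule poly_mapping_eqI)
  fix k l :: "'v \<Rightarrow>\<^sub>0 nat" and x assume "cartier_monom V e k = cartier_monom V e l"
  then have "lookup (cartier_monom V e k) x = lookup (cartier_monom V e l) x" by simp
  then show "lookup k x = lookup l x" using V e by (simp add: lookup_cartier_monom)
qed

lemma lookup_cartier: "lookup (cartier V e P) k = lookup P (cartier_monom V e k)"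
  by (simp add: cartier_def Poly_Mapping.map_key.rep_eq inj_cartier_monom)

lemma cartier_add: "cartier V e (P + Q) = cartier V e P + cartier V e Q"
  by (rule poly_mapping_eqI) (simp add: lookup_cartier lookup_add)

text \<open>The projection formula. The exponent \<open>a + e m\<close> has the form
  \<open>e k + e - 1\<close> on \<open>V\<close> (and \<open>e k\<close> elsewhere) exactly when
  \<open>a\<close> has it, so a factor in \<open>x^e\<close> can be pulled out.\<close>

lemma cartier_mult_frob: "cartier V e (P * frob e e Q) = cartier V e P * frob 1 e Q"
proof (induction P rule: poly_mapping_add_induct)
  case (single a c)
  show ?case
  proof (induction Q rule: poly_mapping_add_induct)
    case (single m d)
    show ?case
    proof (cases "\<exists>b. a = cartier_monom V e b")
      case True
      then obtain b where b: "a = cartier_monom V e b" by blast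
      then have "a + scale_monom e m = cartier_monom V e (b + m)"
        by (simp add: cartier_monom_def scale_monom_add ac_simps)
      then show ?thesis
        by (simp add: mult_single cartier_def b inj_cartier_monom) (simp add: scale_monom_Suc_0)
    next
      case False
      have "a + scale_monom e m \<noteq> cartier_monom V e b" for b
      proof
        assume eq: "a + scale_monom e m = cartier_monom V e b"
        have *: "lookup a x + e * lookup m x = e * lookup b x + (if x \<in> V then e - 1 else 0)" for x
          using arg_cong[OF eq, of "\<lambda>k. lookup k x"] V by (simp add: lookup_add lookup_cartier_monom)
        \<comment> \<open>This makes the truncated subtraction \<open>b - m\<close> below exact.
          Otherwise \<open>e * (lookup b x + 1)\<close> would be at most
          \<open>e * lookup b x + (e - 1)\<close>.\<close>
        have "lookup m x \<le> lookup b x" for x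
        proof (rule ccontr)
          assume "\<not> lookup m x \<le> lookup b x"
          then have "e * (lookup b x + 1) \<le> e * lookup m x" by (intro mult_le_mono) auto
          then show False using *[of x] e by (auto split: if_splits)
        qed
        then have le: "e * lookup m x \<le> e * lookup b x" for x
          by (rule mult_le_mono2)
        have "a = cartier_monom V e (b - m)"
        proof (rule poly_mapping_eqI)
          fix x
          show "lookup a x = lookup (cartier_monom V e (b - m)) x"
            using *[of x] le[of x] V
            by (simp add: lookup_cartier_monom lookup_minus diff_mult_distrib2)
        qed
        then show False using False by blast
      qed
      then have 1: "cartier V e (single (a + scale_monom e m) c') = 0" for c' :: "int poly"
        by (intro poly_mapping_eqI) (simp add: lookup_cartier lookup_single when_def)
      have 2: "cartier V e (single a c) = 0"
        using False by (intro poly_mapping_eqI) (auto simp add: lookup_cartier lookup_single when_def)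
      show ?thesis by (simp add: 1 2 mult_single)
    qed
  qed (simp add: frob.hom_add distrib_left cartier_add)
qed (simp add: cartier_add distrib_right)

lemma cartier_mult_coeff: "cartier V e (single 0 (c :: 'c::comm_ring_1) * P) = single 0 c * cartier V e P"
proof (induction P rule: poly_mapping_add_induct)
  case (single a d)
  show ?case
  proof (cases "\<exists>b. a = cartier_monom V e b")
    case True
    then show ?thesis by (auto simp add: mult_single cartier_def inj_cartier_monom)
  next
    case False
    then have "cartier V e (single a c') = 0" for c' :: 'c
      by (intro poly_mapping_eqI) (auto simp add: lookup_cartier lookup_single when_def)
    then show ?thesis by (simp add: mult_single)
  qed
qed (simp add: cartier_add distrib_left)

end

lemma lookup_coeff_mult: "lookup (single 0 c * P) k = c * lookup P (k :: 'a :: comm_monoid_add)"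
  by (induction P rule: poly_mapping_add_induct)
    (simp_all add: mult_single lookup_single lookup_add distrib_left when_def)

section \<open>Alternating polynomials\<close>

definition frob_lift :: "nat \<Rightarrow> (('v \<Rightarrow>\<^sub>0 nat) \<Rightarrow>\<^sub>0 int poly) \<Rightarrow> bool" where
  "frob_lift p P \<longleftrightarrow> (\<forall>t. of_nat p dvd frob (p ^ t) (p ^ t) P - P ^ p ^ t)"

text \<open>Frobenius additivity is applied to the sum \<open>(P - Q) + Q\<close>, so that no sign
  of a power of \<open>- Q\<close> has to be discussed.\<close>

lemma frob_lift_diff:
  assumes p: "prime p" and P: "frob_lift p P" and Q: "frob_lift p Q"
  shows "frob_lift p (P - Q)"
  unfolding frob_lift_def
proof
  fix t
  let ?F = "frob (p ^ t) (p ^ t)" and ?q = "p ^ t"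
  have "of_nat p dvd (?F P - P ^ ?q) - (?F Q - Q ^ ?q) + (((P - Q) + Q) ^ ?q - ((P - Q) ^ ?q + Q ^ ?q))"
    using P Q dvd_prime_power_add[OF p, of "P - Q" Q t] unfolding frob_lift_def
    by (metis dvd_add dvd_diff)
  then show "of_nat p dvd ?F (P - Q) - (P - Q) ^ ?q"
    by (simp add: frob.hom_diff algebra_simps)
qed

lemma frob_lift_1: "frob_lift p 1"
  by (simp add: frob_lift_def)

lemma frob_lift_uminus:
  assumes "prime p" and "frob_lift p P"
  shows "frob_lift p (- P)"
  using frob_lift_diff[OF assms(1) frob_lift_diff[OF assms(1) assms(2) assms(2)] assms(2)] by simp

lemma frob_lift_mult:
  assumes P: "frob_lift p P" and Q: "frob_lift p Q"
  shows "frob_lift p (P * Q)"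
  unfolding frob_lift_def
proof
  fix t
  let ?F = "frob (p ^ t) (p ^ t)" and ?q = "p ^ t"
  have "of_nat p dvd ?F P * (?F Q - Q ^ ?q) + (?F P - P ^ ?q) * Q ^ ?q"
    using P Q unfolding frob_lift_def by (intro dvd_add dvd_mult dvd_mult2) auto
  then show "of_nat p dvd ?F (P * Q) - (P * Q) ^ ?q"
    by (simp add: frob.hom_mult algebra_simps power_mult_distrib)
qed

lemma frob_lift_power: "frob_lift p P \<Longrightarrow> frob_lift p (P ^ m)"
  by (induction m) (auto intro: frob_lift_mult frob_lift_1)

lemma frob_lift_prod: "(\<And>i. i \<in> I \<Longrightarrow> frob_lift p (f i)) \<Longrightarrow> frob_lift p (\<Prod>i\<in>I. f i)"
  by (induction I rule: infinite_finite_induct) (auto intro: frob_lift_mult frob_lift_1)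

section \<open>Degree bounds in each variable separately\<close>

definition degree_le :: "(('v \<Rightarrow>\<^sub>0 nat) \<Rightarrow>\<^sub>0 'c::zero) \<Rightarrow> ('v \<Rightarrow> nat) \<Rightarrow> bool" where
  "degree_le P d \<longleftrightarrow> (\<forall>k\<in>keys P. \<forall>x. lookup k x \<le> d x)"

lemma degree_le_mono: "degree_le P d \<Longrightarrow> (\<And>x. d x \<le> d' x) \<Longrightarrow> degree_le P d'"
  unfolding degree_le_def using le_trans by blast

lemma degree_le_1: "degree_le 1 d"
  by (simp add: degree_le_def)

lemma degree_le_diff:
  fixes P Q :: "('v \<Rightarrow>\<^sub>0 nat) \<Rightarrow>\<^sub>0 'c::ab_group_add"
  assumes "degree_le P d" and "degree_le Q d"
  shows "degree_le (P - Q) d"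
  using assms Poly_Mapping.keys_diff[of P Q] unfolding degree_le_def by blast

lemma degree_le_sum: "(\<And>i. i \<in> I \<Longrightarrow> degree_le (f i) d) \<Longrightarrow> degree_le (\<Sum>i\<in>I. f i) d"
  using Poly_Mapping.keys_sum[of f I] unfolding degree_le_def by blast

lemma degree_le_mult:
  assumes "degree_le P d" and "degree_le Q d'"
  shows "degree_le (P * Q) (\<lambda>x. d x + d' x)"
  unfolding degree_le_def
proof (intro ballI allI)
  fix k x assume "k \<in> keys (P * Q)"
  then obtain a b where "k = a + b" "a \<in> keys P" "b \<in> keys Q"
    using Poly_Mapping.keys_mult by blast
  with assms show "lookup k x \<le> d x + d' x"
    unfolding degree_le_def by (simp add: lookup_add add_mono)
qed

lemma degree_le_power:
  fixes P :: "('v \<Rightarrow>\<^sub>0 nat) \<Rightarrow>\<^sub>0 'c::comm_semiring_1"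
  assumes "degree_le P d"
  shows "degree_le (P ^ m) (\<lambda>x. m * d x)"
proof (induction m)
  case (Suc m)
  from degree_le_mult[OF assms Suc] show ?case by simp
qed (simp add: degree_le_1)

lemma degree_le_prod:
  fixes f :: "'i \<Rightarrow> ('v \<Rightarrow>\<^sub>0 nat) \<Rightarrow>\<^sub>0 'c::comm_semiring_1"
  assumes "\<And>i. i \<in> I \<Longrightarrow> degree_le (f i) (d i)"
  shows "degree_le (\<Prod>i\<in>I. f i) (\<lambda>x. \<Sum>i\<in>I. d i x)"
  using assms
proof (induction I rule: infinite_finite_induct)
  case (insert i I)
  then show ?case by (simp add: degree_le_mult)
qed (simp_all add: degree_le_1)

lemma degree_le_frob:
  assumes "degree_le P d"
  shows "degree_le (frob a b P) (\<lambda>x. a * d x)"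
  using assms frob.keys_hom[of a b P] unfolding degree_le_def by fastforce

section \<open>Rows of variables and the rank one property\<close>

definition vars :: "nat set \<Rightarrow> (nat \<Rightarrow> nat) \<Rightarrow> (nat \<times> nat) set" where
  "vars M v = (SIGMA m:M. {1..v m})"

abbreviation adj :: "nat \<Rightarrow> nat \<Rightarrow> nat \<times> nat \<Rightarrow> nat \<times> nat" where
  "adj m a \<equiv> transpose (m, a) (m, Suc a)"

text \<open>Adjacent transpositions generate the symmetric group of each row. The condition is put
  on coefficients because it is used to compare coefficients.\<close>

definition alternating :: "nat set \<Rightarrow> (nat \<Rightarrow> nat) \<Rightarrow> xz_poly \<Rightarrow> bool" where
  "alternating M v P \<longleftrightarrow>
    (\<forall>m\<in>M. \<forall>a\<in>{1..<v m}. \<forall>k. lookup P (permute_monom (adj m a) k) = - lookup P k)"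

text \<open>The exponent of the diagonal term of the product of the Vandermonde determinants of the
  rows; \<open>staircase_box\<close> is the degree of that product in each variable.\<close>

definition staircase :: "nat set \<Rightarrow> (nat \<Rightarrow> nat) \<Rightarrow> monomial" where
  "staircase M v = (\<Sum>x\<in>vars M v. single x (snd x - 1))"

definition staircase_box :: "nat set \<Rightarrow> (nat \<Rightarrow> nat) \<Rightarrow> nat \<times> nat \<Rightarrow> nat" where
  "staircase_box M v x = (if x \<in> vars M v then v (fst x) - 1 else 0)"

lemma finite_vars: "finite M \<Longrightarrow> finite (vars M v)"
  by (simp add: vars_def)

lemma lookup_staircase:
  "finite M \<Longrightarrow> lookup (staircase M v) x = (if x \<in> vars M v then snd x - 1 else 0)"
  by (simp add: staircase_def lookup_sum lookup_single when_def finite_vars)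

text \<open>There are only \<open>v\<close> possible values for \<open>v\<close> strictly increasing
  numbers. Induction from the bottom gives the lower bound, induction from the top the upper
  one.\<close>

lemma strictly_increasing_bounded_eq:
  fixes f :: "nat \<Rightarrow> nat"
  assumes inc: "\<And>a. a \<in> {1..<v} \<Longrightarrow> f a < f (Suc a)" and ub: "\<And>a. a \<in> {1..v} \<Longrightarrow> f a \<le> v - 1"
    and j: "j \<in> {1..v}"
  shows "f j = j - 1"
proof (rule antisym)
  have "i \<le> v \<Longrightarrow> i \<ge> 1 \<Longrightarrow> i - 1 \<le> f i" for i
  proof (induction i)
    case (Suc i)
    then show ?case using inc[of i] by (cases "i = 0") auto
  qed simp
  then show "j - 1 \<le> f j" using j by auto
  have "i < v \<Longrightarrow> f (v - i) \<le> v - i - 1" for i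
  proof (induction i)
    case 0
    then show ?case using ub[of v] by auto
  next
    case (Suc i)
    have "f (v - Suc i) < f (Suc (v - Suc i))" by (rule inc) (use Suc.prems in auto)
    then show ?case using Suc by (simp add: Suc_diff_Suc)
  qed
  from this[of "v - j"] show "f j \<le> j - 1" using j by auto
qed

text \<open>Sorting the exponents within each row by adjacent swaps reduces every coefficient to that of the staircase.\<close>

lemma alternating_eq_0:
  assumes M: "finite M" and alt: "alternating M v P"
    and deg: "degree_le P (staircase_box M v)" and 0: "lookup P (staircase M v) = 0"
  shows "P = 0"
proof (rule poly_mapping_eqI)
  fix k
  \<comment> \<open>The weights decrease along a row, so moving the larger of two adjacent exponents
    to the right lowers this measure.\<close>
  define f where "f k = (\<Sum>x\<in>vars M v. (v (fst x) - snd x) * lookup k x)" for k :: monomial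
  have "lookup P k = 0"
  proof (induction "f k" arbitrary: k rule: less_induct)
    case less
    show ?case
    proof (cases "k \<in> keys P")
      case True
      show ?thesis
      proof (cases "\<exists>m\<in>M. \<exists>a\<in>{1..<v m}. lookup k (m, Suc a) \<le> lookup k (m, a)")
        case True
        then obtain m a where ma: "m \<in> M" "a \<in> {1..<v m}" and le: "lookup k (m, Suc a) \<le> lookup k (m, a)"
          by blast
        let ?k = "permute_monom (adj m a) k"
        have sgn: "lookup P ?k = - lookup P k" using alt ma unfolding alternating_def by blast
        show ?thesis
        proof (cases "lookup k (m, Suc a) = lookup k (m, a)")
          case True
          \<comment> \<open>A tie: the swap fixes the monomial, so its coefficient equals its own
            negative.\<close>
          then have "?k = k"
            by (intro poly_mapping_eqI) (auto simp: transpose_def)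
          then show ?thesis using sgn by simp
        next
          case False
          let ?R = "vars M v - {(m, a), (m, Suc a)}"
          have V: "vars M v = insert (m, a) (insert (m, Suc a) ?R)"
            using ma by (auto simp: vars_def)
          have fin: "finite ?R" using M by (simp add: finite_vars)
          have split: "f l = (v m - a) * lookup l (m, a) + (v m - Suc a) * lookup l (m, Suc a)
              + (\<Sum>x\<in>?R. (v (fst x) - snd x) * lookup l x)" for l
            unfolding f_def by (subst V) (use fin in simp)
          have "(\<Sum>x\<in>?R. (v (fst x) - snd x) * lookup ?k x) = (\<Sum>x\<in>?R. (v (fst x) - snd x) * lookup k x)"
            by (intro sum.cong) (auto simp: transpose_def)
          moreover obtain c where "v m = Suc a + c" using ma by (metis atLeastLessThan_iff less_eq_Suc_le le_Suc_ex)
          ultimately have "f ?k < f k"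
            using le False by (simp add: split)
          then show ?thesis using less sgn by fastforce
        qed
      next
        case inc: False
        \<comment> \<open>Now the exponents in every row increase strictly and stay within the box,
          which leaves only the staircase.\<close>
        have bd: "lookup k x \<le> staircase_box M v x" for x
          using deg \<open>k \<in> keys P\<close> unfolding degree_le_def by blast
        have "k = staircase M v"
        proof (rule poly_mapping_eqI)
          fix x :: "nat \<times> nat"
          obtain m j where x: "x = (m, j)" by (cases x)
          show "lookup k x = lookup (staircase M v) x"
          proof (cases "x \<in> vars M v")
            case True
            then have mj: "m \<in> M" "j \<in> {1..v m}" by (auto simp: x vars_def)
            have "lookup k (m, j) = j - 1"
            proof (rule strictly_increasing_bounded_eq)
              show "lookup k (m, a) < lookup k (m, Suc a)" if "a \<in> {1..<v m}" for a
                using that inc mj by (meson not_le)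
              show "lookup k (m, a) \<le> v m - 1" if "a \<in> {1..v m}" for a
                using bd[of "(m, a)"] that mj by (simp add: staircase_box_def vars_def)
            qed (use mj in simp)
            then show ?thesis using M True by (simp add: x lookup_staircase)
          next
            case False
            then show ?thesis using bd[of x] M by (simp add: staircase_box_def lookup_staircase)
          qed
        qed
        then show ?thesis using 0 by simp
      qed
    qed (simp add: in_keys_iff)
  qed
  then show "lookup P k = lookup 0 k" by simp
qed

text \<open>Subtracting the multiple of \<open>D\<close> with the same staircase coefficient leaves
  an alternating polynomial to which \<open>alternating_eq_0\<close> applies.\<close>

lemma alternating_eq_multiple:
  assumes M: "finite M" and D: "alternating M v D" "degree_le D (staircase_box M v)" "lookup D (staircase M v) = 1"
    and P: "alternating M v P" "degree_le P (staircase_box M v)"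
  shows "P = single 0 (lookup P (staircase M v)) * D"
proof -
  define c where "c = lookup P (staircase M v)"
  have "P - single 0 c * D = 0"
  proof (rule alternating_eq_0[OF M])
    show "alternating M v (P - single 0 c * D)"
      using D(1) P(1) by (simp add: alternating_def lookup_minus lookup_coeff_mult)
    have "degree_le (single 0 c * D) (staircase_box M v)"
      using D(2) unfolding degree_le_def by (auto simp: in_keys_iff lookup_coeff_mult)
    then show "degree_le (P - single 0 c * D) (staircase_box M v)"
      using P(2) by (rule degree_le_diff[rotated])
    show "lookup (P - single 0 c * D) (staircase M v) = 0"
      by (simp add: lookup_minus lookup_coeff_mult D c_def)
  qed
  then show ?thesis by (simp add: c_def)
qed

lemma permute_monom_inj: "inj \<tau> \<Longrightarrow> surj \<tau> \<Longrightarrow> inj (permute_monom \<tau>)"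
proof (rule injI, rule poly_mapping_eqI)
  fix k l :: "'a \<Rightarrow>\<^sub>0 nat" and x
  assume \<tau>: "inj \<tau>" "surj \<tau>" and eq: "permute_monom \<tau> k = permute_monom \<tau> l"
  obtain y where "x = \<tau> y" using \<tau>(2) by (metis surjD)
  then show "lookup k x = lookup l x" using \<tau>(1) arg_cong[OF eq, of "\<lambda>k. lookup k y"] by simp
qed

lemma alternatingI:
  assumes "\<And>m a. m \<in> M \<Longrightarrow> a \<in> {1..<v m} \<Longrightarrow> permute_vars (adj m a) P = - P"
  shows "alternating M v P"
  unfolding alternating_def
proof (intro ballI allI)
  fix m a k assume ma: "m \<in> M" "a \<in> {1..<v m}"
  have "lookup (permute_vars (adj m a) P) (permute_monom (adj m a) k) = lookup P k"
    using monomial_hom.lookup_hom_inj[OF permute_vars_hom, of "adj m a" "Suc 0" P k]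
    by (simp add: subst_power_1 permute_monom_inj)
  then have "lookup (- P) (permute_monom (adj m a) k) = lookup P k"
    by (simp add: assms[OF ma, simplified])
  then show "lookup P (permute_monom (adj m a) k) = - lookup P k" by simp
qed

text \<open>The operator treats all variables of a row alike, so its exponent map commutes with
  swaps inside the row.\<close>

lemma alternating_cartier:
  assumes M: "finite M" and e: "e > 0" and P: "alternating M v P"
  shows "alternating M v (cartier (vars M v) e P)"
  unfolding alternating_def
proof (intro ballI allI)
  fix m a k assume ma: "m \<in> M" "a \<in> {1..<v m}"
  let ?\<tau> = "permute_monom (adj m a)" and ?c = "cartier_monom (vars M v) e"
  have "(adj m a x \<in> vars M v) = (x \<in> vars M v)" for x
    using ma by (auto simp: vars_def transpose_def split: if_splits)
  then have "?c (?\<tau> k) = ?\<tau> (?c k)"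
    using M by (intro poly_mapping_eqI) (simp add: lookup_cartier_monom finite_vars)
  then show "lookup (cartier (vars M v) e P) (?\<tau> k) = - lookup (cartier (vars M v) e P) k"
    using P ma M e unfolding alternating_def by (simp add: lookup_cartier finite_vars)
qed

lemma cartier_cartier:
  assumes V: "finite V" and "a > 0" "b > 0"
  shows "cartier V a (cartier V b P) = cartier V (a * b) P"
proof (rule poly_mapping_eqI)
  fix k
  have "cartier_monom V b (cartier_monom V a k) = cartier_monom V (a * b) k"
  proof (rule poly_mapping_eqI)
    fix x
    have "b * (a - 1) + (b - 1) = a * b - 1"
      using assms by (cases a; cases b) (auto simp: algebra_simps)
    then show "lookup (cartier_monom V b (cartier_monom V a k)) x = lookup (cartier_monom V (a * b) k) x"
      using V by (simp add: lookup_cartier_monom algebra_simps)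
  qed
  then show "lookup (cartier V a (cartier V b P)) k = lookup (cartier V (a * b) P) k"
    using assms by (simp add: lookup_cartier)
qed

section \<open>The recursion for an abstract master polynomial\<close>

text \<open>\<open>D\<close> plays the role of the Vandermonde product and \<open>G\<close> that of
  the signed master polynomial. \<open>D_frob\<close> says that \<open>D\<close> does not involve
  \<open>z\<close>; \<open>c\<close> is the surplus of the degree of \<open>G\<close> over
  \<open>p - 1\<close> times the length of the row.\<close>

locale symmetric_master =
  fixes M :: "nat set" and v :: "nat \<Rightarrow> nat" and D G :: xz_poly and p c :: nat
  assumes M: "finite M" and p: "prime p" and c: "c < p"
    and D_alt: "\<And>m a. m \<in> M \<Longrightarrow> a \<in> {1..<v m} \<Longrightarrow> permute_vars (adj m a) D = - D"
    and D_deg: "degree_le D (staircase_box M v)"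
    and D_lead: "lookup D (staircase M v) = 1"
    and D_frob: "\<And>e. frob 1 e D = D"
    and G_sym: "\<And>m a. m \<in> M \<Longrightarrow> a \<in> {1..<v m} \<Longrightarrow> permute_vars (adj m a) G = G"
    and G_deg: "degree_le G (\<lambda>x. if x \<in> vars M v then (p - 1) * v (fst x) + c else 0)"
    and G_lift: "frob_lift p G"
begin

abbreviation "V \<equiv> vars M v"
abbreviation "\<rho> \<equiv> staircase M v"
abbreviation "I \<equiv> ghost (\<lambda>t. frob (p ^ t) (p ^ t)) p G"
abbreviation "g x \<equiv> if x \<in> V then (p - 1) * v (fst x) + c else 0"

definition T :: "nat \<Rightarrow> int poly" where
  "T s = lookup (cartier V (p ^ s) (D * G ^ repunit p s)) \<rho>"

text \<open>The factor by which the Cartier image of \<open>D * I t\<close> is a multiple of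
  \<open>D\<close>, by \<open>cartier_eq\<close>.\<close>

definition d :: "nat \<Rightarrow> int poly" where
  "d t = lookup (cartier V (p ^ t) (D * I t)) \<rho>"

lemma p_pos: "p > 0"
  using p by (simp add: prime_gt_0_nat)

text \<open>For a row of length \<open>w\<close>, an exponent \<open>k\<close> of the image
  satisfies \<open>p^t k + p^t - 1 \<le> w - 1 + [t]((p - 1) w + c)\<close>. Since
  \<open>[t](p - 1) = p^t - 1\<close> and \<open>[t] c \<le> p^t - 1\<close>, this gives
  \<open>p^t (k + 1) < p^t (w + 1)\<close>, so the image lies in the box where only multiples of
  \<open>D\<close> are alternating.\<close>

lemma cartier_eq:
  assumes sym: "\<And>m a. m \<in> M \<Longrightarrow> a \<in> {1..<v m} \<Longrightarrow> permute_vars (adj m a) Q = Q"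
    and deg: "degree_le Q (\<lambda>x. repunit p t * g x)"
  shows "cartier V (p ^ t) (D * Q) = single 0 (lookup (cartier V (p ^ t) (D * Q)) \<rho>) * D"
proof (rule alternating_eq_multiple[OF M _ D_deg D_lead])
  show "alternating M v D" using D_alt by (rule alternatingI)
  have "permute_vars (adj m a) (D * Q) = - (D * Q)" if "m \<in> M" "a \<in> {1..<v m}" for m a
    by (subst monomial_hom.hom_mult[OF permute_vars_hom]) (simp_all add: D_alt[OF that, simplified] sym[OF that, simplified])
  then show "alternating M v (cartier V (p ^ t) (D * Q))"
    using M p_pos by (intro alternating_cartier alternatingI) auto
  show "degree_le (cartier V (p ^ t) (D * Q)) (staircase_box M v)"
    unfolding degree_le_def
  proof (intro ballI allI)
    fix k x assume "k \<in> keys (cartier V (p ^ t) (D * Q))"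
    then have "cartier_monom V (p ^ t) k \<in> keys (D * Q)"
      using M p_pos by (simp add: in_keys_iff lookup_cartier finite_vars)
    with degree_le_mult[OF D_deg deg]
    have "lookup (cartier_monom V (p ^ t) k) x \<le> staircase_box M v x + repunit p t * g x"
      unfolding degree_le_def by blast
    then have le: "p ^ t * lookup k x + (if x \<in> V then p ^ t - 1 else 0) \<le> staircase_box M v x + repunit p t * g x"
      using M by (simp add: lookup_cartier_monom finite_vars)
    show "lookup k x \<le> staircase_box M v x"
    proof (cases "x \<in> V")
      case True
      define w where "w = v (fst x)"
      have w: "w > 0" using True by (auto simp: w_def vars_def)
      have q: "p ^ t > 0" using p_pos by simp
      have r: "repunit p t * (p - 1) = p ^ t - 1" using p_pos by (intro repunit_mult) simp
      \<comment> \<open>Here \<open>c < p\<close> enters: the surplus stays below one full step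
        \<open>p ^ t\<close> of the operator.\<close>
      have "repunit p t * c \<le> repunit p t * (p - 1)" using c by (intro mult_le_mono2) simp
      also note r
      finally have rc: "repunit p t * c \<le> p ^ t - 1" .
      have "p ^ t * lookup k x + (p ^ t - 1) \<le> w - 1 + repunit p t * ((p - 1) * w + c)"
        using le True by (simp add: staircase_box_def w_def)
      moreover have "repunit p t * ((p - 1) * w + c) = (p ^ t - 1) * w + repunit p t * c"
        by (metis r distrib_left mult.assoc)
      moreover have "w - 1 + (p ^ t - 1) * w + 1 = p ^ t * w"
        using w q by (cases "p ^ t") simp_all
      moreover have "p ^ t * (lookup k x + 1) = p ^ t * lookup k x + p ^ t" "p ^ t * (w + 1) = p ^ t * w + p ^ t"
        by simp_all
      ultimately have "p ^ t * (lookup k x + 1) < p ^ t * (w + 1)"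
        using rc q by linarith
      then have "lookup k x < w" using q by simp
      then show ?thesis using True by (simp add: staircase_box_def w_def)
    next
      case False
      then show ?thesis using le p_pos by (simp add: staircase_box_def)
    qed
  qed
qed

end

context symmetric_master
begin

lemma G_power_sym:
  "m \<in> M \<Longrightarrow> a \<in> {1..<v m} \<Longrightarrow> permute_vars (adj m a) (G ^ j) = G ^ j"
  by (subst monomial_hom.hom_power[OF permute_vars_hom]) (simp_all add: G_sym)

lemma permute_monom_scale: "inj \<tau> \<Longrightarrow> permute_monom \<tau> (scale_monom e k) = scale_monom e (permute_monom \<tau> k)"
  by (rule poly_mapping_eqI) simp

lemma permute_vars_frob:
  assumes "inj \<tau>"
  shows "permute_vars \<tau> (frob a b P) = frob a b (permute_vars \<tau> P)"
proof -
  interpret perm: monomial_hom "permute_monom \<tau>" "subst_power (Suc 0)"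
    using assms by (rule permute_vars_hom)
  show ?thesis
  proof (induction P rule: poly_mapping_add_induct)
    case (single k c)
    show ?case by (simp only: frob.hom_single perm.hom_single permute_monom_scale[OF assms]) (simp only: subst_power_1)
  next
    case (add P Q)
    then show ?case by (simp only: frob.hom_add perm.hom_add)
  qed
qed

lemma ghost_sym:
  assumes "m \<in> M" "a \<in> {1..<v m}"
  shows "permute_vars (adj m a) (I t) = I t"
proof (induction t rule: less_induct)
  case (less t)
  interpret perm: monomial_hom "permute_monom (adj m a)" "subst_power (Suc 0)"
    by (rule permute_vars_hom) simp
  have "perm.H (I i * frob (p ^ i) (p ^ i) (G ^ j)) = I i * frob (p ^ i) (p ^ i) (G ^ j)" if "i < t" for i j
  proof -
    have "inj (adj m a)" by simp
    then show ?thesis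
      by (simp only: perm.hom_mult less[OF that] permute_vars_frob G_power_sym[OF assms])
  qed
  then show ?case
    unfolding ghost.simps[of _ p G t] perm.hom_diff perm.hom_sum G_power_sym[OF assms]
    by (intro arg_cong2[where f = minus] sum.cong refl) auto
qed

text \<open>The products in the recursion meet the bound of the leading power because
  \<open>[i] + p^i [t - i] = [t]\<close>.\<close>

lemma ghost_degree: "degree_le (I t) (\<lambda>x. repunit p t * g x)"
proof (induction t rule: less_induct)
  case (less t)
  have "degree_le (I i * frob (p ^ i) (p ^ i) (G ^ repunit p (t - i))) (\<lambda>x. repunit p t * g x)"
    if i: "i \<in> {1..<t}" for i
  proof (rule degree_le_mono)
    show "degree_le (I i * frob (p ^ i) (p ^ i) (G ^ repunit p (t - i)))
        (\<lambda>x. repunit p i * g x + p ^ i * (repunit p (t - i) * g x))"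
      using i by (intro degree_le_mult less degree_le_frob degree_le_power G_deg) simp
    show "repunit p i * g x + p ^ i * (repunit p (t - i) * g x) \<le> repunit p t * g x" for x
      using repunit_add[of p i "t - i"] i by (simp add: algebra_simps)
  qed
  then show ?case
    unfolding ghost.simps[of _ p G t] by (intro degree_le_diff degree_le_sum degree_le_power G_deg)
qed

text \<open>The operator of level \<open>p ^ s\<close> is applied as level \<open>p ^ t\<close>
  followed by level \<open>p ^ (s - t)\<close>. The first turns \<open>D * I t\<close> into
  \<open>d t\<close> times \<open>D\<close> and the Frobenius factor into a power of
  \<open>G\<close> at \<open>z^(p^t)\<close>; the second then produces \<open>T (s - t)\<close> at
  \<open>z^(p^t)\<close>.\<close>

lemma T_rec:
  assumes s: "s > 0"
  shows "T s = (\<Sum>t\<in>{1..s}. d t * subst_power (p ^ t) (T (s - t)))"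
proof -
  have V: "finite V" using M by (rule finite_vars)
  have q: "p ^ t > 0" for t using p_pos by simp
  let ?F = "\<lambda>t. frob (p ^ t) (p ^ t)"
  have "G ^ repunit p s = (\<Sum>t\<in>{1..s}. I t * ?F t (G ^ repunit p (s - t)))"
    using s by (intro power_repunit_eq_sum_ghost) simp_all
  then have "T s = lookup (cartier V (p ^ s) (\<Sum>t\<in>{1..s}. D * I t * ?F t (G ^ repunit p (s - t)))) \<rho>"
    by (simp add: T_def sum_distrib_left mult.assoc)
  also have "\<dots> = (\<Sum>t\<in>{1..s}. lookup (cartier V (p ^ s) (D * I t * ?F t (G ^ repunit p (s - t)))) \<rho>)"
    by (simp only: lookup_cartier[OF V q] lookup_sum)
  also have "\<dots> = (\<Sum>t\<in>{1..s}. d t * subst_power (p ^ t) (T (s - t)))"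
  proof (rule sum.cong)
    fix t assume t: "t \<in> {1..s}"
    let ?Q = "G ^ repunit p (s - t)"
    have "cartier V (p ^ s) (D * I t * ?F t ?Q) = cartier V (p ^ (s - t)) (cartier V (p ^ t) (D * I t * ?F t ?Q))"
      using t by (simp only: cartier_cartier[OF V q q] flip: power_add) simp
    also have "cartier V (p ^ t) (D * I t * ?F t ?Q) = cartier V (p ^ t) (D * I t) * frob 1 (p ^ t) ?Q"
      by (rule cartier_mult_frob[OF V q])
    also have "cartier V (p ^ t) (D * I t) = single 0 (d t) * D"
      unfolding d_def by (rule cartier_eq[OF ghost_sym ghost_degree])
    \<comment> \<open>As \<open>D\<close> is free of \<open>z\<close>, it can be moved inside the
      substitution.\<close>
    also have "single 0 (d t) * D * frob 1 (p ^ t) ?Q = single 0 (d t) * frob 1 (p ^ t) (D * ?Q)"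
      by (simp only: frob.hom_mult D_frob mult.assoc)
    also have "cartier V (p ^ (s - t)) \<dots> = single 0 (d t) * cartier V (p ^ (s - t)) (frob 1 (p ^ t) (D * ?Q))"
      by (rule cartier_mult_coeff[OF V q])
    finally show "lookup (cartier V (p ^ s) (D * I t * ?F t ?Q)) \<rho> = d t * subst_power (p ^ t) (T (s - t))"
      by (simp only: lookup_coeff_mult lookup_cartier[OF V q] lookup_frob_1 T_def)
  qed simp
  finally show ?thesis .
qed

text \<open>The integer factor \<open>p ^ (t - 1)\<close> of the ghost term passes through the
  Cartier operator.\<close>

lemma d_dvd: "of_nat p ^ (t - 1) dvd d t"
proof -
  have V: "finite V" using M by (rule finite_vars)
  have q: "p ^ t > 0" for t using p_pos by simp
  have "of_nat p ^ (t - 1) dvd I t"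
    using G_lift by (intro dvd_ghost) (simp_all add: frob.hom_mult frob_lift_def)
  then obtain R where "I t = of_nat (p ^ (t - 1)) * R" by (auto elim!: dvdE)
  then have "D * I t = single 0 (of_nat (p ^ (t - 1))) * (D * R)"
    by (simp only: single_of_nat mult.left_commute)
  then have "d t = of_nat (p ^ (t - 1)) * lookup (cartier V (p ^ t) (D * R)) \<rho>"
    unfolding d_def by (simp only: cartier_mult_coeff[OF V q] lookup_coeff_mult)
  then show ?thesis by simp
qed

end

section \<open>From cross-multiplied congruences to quotients of power series\<close>

lemma fps_right_inverse_unit:
  fixes f :: "int fps"
  assumes "fps_nth f 0 = 1"
  shows "f * fps_right_inverse f 1 = 1"
  using assms by (intro fps_right_inverse) simp

lemma fps_const_dvd_nth:
  fixes F :: "int fps"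
  assumes "of_nat m dvd F"
  shows "int m dvd fps_nth F i"
proof -
  obtain R where "F = of_nat m * R" using assms by (elim dvdE)
  then show ?thesis by (simp flip: fps_of_nat)
qed

lemma fps_cong_quot:
  assumes "poly B 0 = 1" "poly B' 0 = 1"
    and "of_nat m dvd fps_of_poly A * fps_of_poly B' - fps_of_poly A' * fps_of_poly B"
  shows "fps_cong (quot_fps A B) (quot_fps A' B') (int m)"
proof -
  let ?i = "\<lambda>f. fps_right_inverse (fps_of_poly f) (1 :: int)"
  have B: "fps_of_poly B * ?i B = 1" "fps_of_poly B' * ?i B' = 1"
    using assms by (auto intro!: fps_right_inverse_unit simp: poly_0_coeff_0)
  have "(fps_of_poly A * fps_of_poly B' - fps_of_poly A' * fps_of_poly B) * (?i B * ?i B')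
      = fps_of_poly A * ?i B * (fps_of_poly B' * ?i B') - fps_of_poly A' * ?i B' * (fps_of_poly B * ?i B)"
    by (simp add: algebra_simps)
  also have "\<dots> = quot_fps A B - quot_fps A' B'"
    by (simp add: B quot_fps_def)
  finally have "of_nat m dvd quot_fps A B - quot_fps A' B'"
    using assms(3) by (metis dvd_mult2)
  then have "int m dvd fps_nth (quot_fps A B - quot_fps A' B') i" for i
    by (rule fps_const_dvd_nth)
  then show ?thesis
    by (simp add: fps_cong_def cong_iff_dvd_diff)
qed

text \<open>\<open>dwork_congruence\<close> is applied in the power series ring, where constant term
  1 makes every \<open>T s\<close> a unit. Its recursion at shift \<open>j\<close> is
  \<open>T_rec\<close> with \<open>z\<close> replaced by \<open>z^(p^j)\<close>; the case
  \<open>j = 0\<close> is the claim.\<close>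

lemma (in symmetric_master) T_dwork:
  assumes T_0: "\<And>s. poly (T s) 0 = 1" and s: "s > 0"
  shows "fps_cong (quot_fps (T (s + 1)) (subst_power p (T s)))
    (quot_fps (T s) (subst_power p (T (s - 1)))) (int p ^ s)"
proof -
  define u where "u s j = fps_of_poly (subst_power (p ^ j) (T s))" for s j
  define e where "e t j = fps_of_poly (subst_power (p ^ j) (d t))" for t j
  have q: "p ^ j > 0" for j using p_pos by simp
  have subst_sum: "subst_power m (\<Sum>t\<in>A. f t) = (\<Sum>t\<in>A. subst_power m (f t))" for m A and f :: "nat \<Rightarrow> int poly"
    by (simp add: subst_power_def pcompose_sum)
  have "of_nat p ^ s dvd u (s + 1) 0 * u (s - 1) (0 + 1) - u s 0 * u s (0 + 1)"
  proof (rule dwork_congruence[where d = e])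
    show "u s j dvd 1" for s j
    proof (rule dvdI)
      show "1 = u s j * fps_right_inverse (u s j) 1"
        unfolding u_def using T_0 q
        by (intro fps_right_inverse_unit[symmetric]) (simp add: poly_0_coeff_0[symmetric] poly_subst_power_0)
    qed
    show "u s j = (\<Sum>t\<in>{1..s}. e t j * u (s - t) (j + t))" if "s > 0" for s j
      unfolding u_def e_def T_rec[OF that] subst_sum fps_of_poly_sum subst_power_hom
        fps_of_poly_mult subst_power_subst_power power_add ..
    show "of_nat p ^ (t - 1) dvd e t j" for t j
    proof -
      obtain R where "d t = of_nat (p ^ (t - 1)) * R" using d_dvd[of t] by (auto elim!: dvdE)
      moreover have "subst_power m (of_nat a) = of_nat a" for m a
        by (simp add: subst_power_def of_nat_poly)
      moreover have "fps_of_poly (of_nat a) = (of_nat a :: int fps)" for a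
        by (simp add: of_nat_poly fps_of_poly_const fps_of_nat)
      ultimately have "e t j = of_nat (p ^ (t - 1)) * fps_of_poly (subst_power (p ^ j) R)"
        by (simp only: e_def subst_power_hom fps_of_poly_mult)
      then show ?thesis by simp
    qed
  qed (rule s)
  then have "of_nat (p ^ s) dvd fps_of_poly (T (s + 1)) * fps_of_poly (subst_power p (T (s - 1)))
      - fps_of_poly (T s) * fps_of_poly (subst_power p (T s))"
    by (simp add: u_def subst_power_1)
  then have "fps_cong (quot_fps (T (s + 1)) (subst_power p (T s)))
    (quot_fps (T s) (subst_power p (T (s - 1)))) (int (p ^ s))"
    using p_pos T_0 by (intro fps_cong_quot) (simp_all add: poly_subst_power_0)
  then show ?thesis by simp
qed

section \<open>Initial monomials\<close>

definition weight :: "('v \<Rightarrow> nat) \<Rightarrow> ('v \<Rightarrow>\<^sub>0 nat) \<Rightarrow> nat" where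
  "weight w k = (\<Sum>x\<in>keys k. w x * lookup k x)"

lemma weight_add: "weight w (k + l) = weight w k + weight w l"
  unfolding weight_def by (rule Poly_Mapping.setsum_keys_plus_distrib) (simp_all add: algebra_simps)

lemma weight_0 [simp]: "weight w 0 = 0"
  by (simp add: weight_def)

lemma weight_single [simp]: "weight w (single x a) = w x * a"
  by (simp add: weight_def)

text \<open>For \<open>c\<close> nonzero, \<open>w\<close> singles out the vertex \<open>a\<close>
  of the Newton polytope of \<open>P\<close> at \<open>z = 0\<close>. Strictness of the inequality
  makes the notion multiplicative.\<close>

definition has_initial :: "('v \<Rightarrow> nat) \<Rightarrow> (('v \<Rightarrow>\<^sub>0 nat) \<Rightarrow>\<^sub>0 int poly) \<Rightarrow> ('v \<Rightarrow>\<^sub>0 nat) \<Rightarrow> int \<Rightarrow> bool" where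
  "has_initial w P a c \<longleftrightarrow> (\<forall>k\<in>keys (at_zero P - single a c). weight w a < weight w k)"

lemma has_initial_lookup:
  assumes "has_initial w P a c"
  shows "poly (lookup P a) 0 = c"
proof -
  have "a \<notin> keys (at_zero P - single a c)"
    using assms unfolding has_initial_def by blast
  then have "lookup (at_zero P) a = c" by (simp add: in_keys_iff lookup_minus)
  then show ?thesis by (simp only: lookup_at_zero)
qed

lemma has_initial_1: "has_initial w 1 0 1"
  unfolding has_initial_def at_zero.hom_1 by (simp add: in_keys_iff)

text \<open>With initial terms \<open>A\<close> and \<open>B\<close>, the difference
  \<open>P Q - A B\<close> is \<open>(P - A) Q + A (Q - B)\<close>, and in each summand one factor
  has strictly larger weight.\<close>

lemma has_initial_mult:
  assumes P: "has_initial w P a c" and Q: "has_initial w Q b d"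
  shows "has_initial w (P * Q) (a + b) (c * d)"
  unfolding has_initial_def
proof
  fix k assume k: "k \<in> keys (at_zero (P * Q) - single (a + b) (c * d))"
  let ?P = "at_zero P" and ?Q = "at_zero Q" and ?A = "single a c" and ?B = "single b d"
  have "at_zero (P * Q) - single (a + b) (c * d) = (?P - ?A) * ?Q + ?A * (?Q - ?B)"
    by (simp only: at_zero.hom_mult mult_single[symmetric]) (simp add: algebra_simps)
  then have "k \<in> keys ((?P - ?A) * ?Q) \<or> k \<in> keys (?A * (?Q - ?B))"
    using k Poly_Mapping.keys_add[of "(?P - ?A) * ?Q" "?A * (?Q - ?B)"] by auto
  then show "weight w (a + b) < weight w k"
  proof
    assume "k \<in> keys ((?P - ?A) * ?Q)"
    then obtain x y where xy: "k = x + y" "x \<in> keys (?P - ?A)" "y \<in> keys ?Q"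
      using Poly_Mapping.keys_mult by blast
    have "y \<in> keys (?Q - ?B) \<or> y = b"
      using xy(3) by (auto simp: in_keys_iff lookup_minus lookup_single when_def)
    then have "weight w b \<le> weight w y"
      using Q unfolding has_initial_def by (auto intro: less_imp_le)
    moreover have "weight w a < weight w x" using P xy(2) unfolding has_initial_def by blast
    ultimately show ?thesis by (simp add: xy(1) weight_add)
  next
    assume "k \<in> keys (?A * (?Q - ?B))"
    then obtain x y where xy: "k = x + y" "x \<in> keys ?A" "y \<in> keys (?Q - ?B)"
      using Poly_Mapping.keys_mult by blast
    have "x = a" using xy(2) by (simp split: if_splits)
    moreover have "weight w b < weight w y" using Q xy(3) unfolding has_initial_def by blast
    ultimately show ?thesis by (simp add: xy(1) weight_add)
  qed
qed

lemma has_initial_power: "has_initial w P a c \<Longrightarrow> has_initial w (P ^ m) (scale_monom m a) (c ^ m)"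
  by (induction m) (simp_all add: has_initial_1 has_initial_mult scale_monom_Suc)

lemma has_initial_prod:
  "(\<And>i. i \<in> I \<Longrightarrow> has_initial w (f i) (a i) (c i)) \<Longrightarrow>
    has_initial w (\<Prod>i\<in>I. f i) (\<Sum>i\<in>I. a i) (\<Prod>i\<in>I. c i)"
  by (induction I rule: infinite_finite_induct) (simp_all add: has_initial_1 has_initial_mult)

section \<open>The linear factors: initial terms, Frobenius, degrees, permutations\<close>

lemma at_zero_X: "at_zero (X i j) = single (single (i, j) 1) 1"
  unfolding X_def by (subst at_zero.hom_single) (simp add: scale_monom_single)

lemma at_zero_Z: "at_zero Z = 0"
  unfolding Z_def by (subst at_zero.hom_single) simp

lemma has_initial_X: "has_initial w (X i j) (single (i, j) 1) 1"
  unfolding has_initial_def at_zero_X by simp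

lemma has_initial_X_diff:
  assumes "w (i, j) \<noteq> w (i', j')"
  shows "has_initial w (X i j - X i' j')
    (single (if w (i', j') < w (i, j) then (i', j') else (i, j)) 1) (if w (i', j') < w (i, j) then -1 else 1)"
  unfolding has_initial_def at_zero.hom_diff at_zero_X
  using assms by (auto simp: in_keys_iff lookup_minus lookup_single when_def split: if_splits)

lemma has_initial_Z_diff: "has_initial w (Z - X i j) (single (i, j) 1) (-1)"
  unfolding has_initial_def at_zero.hom_diff at_zero_X at_zero_Z
  by (auto simp: in_keys_iff lookup_minus lookup_single when_def split: if_splits)

lemma has_initial_one_diff:
  assumes "w (i, j) > 0"
  shows "has_initial w (1 - X i j) 0 1"
  unfolding has_initial_def at_zero.hom_diff at_zero_X at_zero.hom_1
  using assms by (auto simp: in_keys_iff lookup_minus lookup_single lookup_one when_def split: if_splits)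

lemma frob_lift_X: "frob_lift p (X i j)"
proof -
  have "X i j ^ m = single (single (i, j) m) 1" for m
    by (induction m) (simp_all add: X_def mult_single flip: single_add)
  moreover have "frob m m (X i j) = single (single (i, j) m) 1" for m
    unfolding X_def by (subst frob.hom_single) (simp add: scale_monom_single subst_power_hom)
  ultimately show ?thesis by (simp add: frob_lift_def)
qed

lemma frob_lift_Z: "frob_lift p Z"
proof -
  have "Z ^ m = single 0 (monom 1 m)" for m
    by (induction m) (simp_all add: Z_def mult_single monom_Suc)
  moreover have "frob m m Z = single 0 (monom 1 m)" for m
    unfolding Z_def by (subst frob.hom_single) (simp add: subst_power_def pcompose_pCons)
  ultimately show ?thesis by (simp add: frob_lift_def)
qed

lemma frob_1_X: "frob 1 e (X i j) = X i j"
  unfolding X_def by (subst frob.hom_single) (simp add: scale_monom_single subst_power_hom)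

lemma frob_1_Delta: "frob 1 e (Delta k n) = Delta k n"
  unfolding Delta_def frob.hom_prod frob.hom_diff frob_1_X ..

lemma degree_le_X: "degree_le (X i j) (\<lambda>x. of_bool (x = (i, j)))"
  by (simp add: degree_le_def X_def lookup_single when_def)

lemma degree_le_X_diff: "degree_le (X i j - X i' j') (\<lambda>x. of_bool (x = (i, j)) + of_bool (x = (i', j')))"
  by (rule degree_le_diff; rule degree_le_mono[OF degree_le_X]) simp_all

lemma degree_le_Z_diff: "degree_le (Z - X i j) (\<lambda>x. of_bool (x = (i, j)))"
  by (rule degree_le_diff[OF _ degree_le_X]) (simp add: degree_le_def Z_def)

lemma degree_le_one_diff: "degree_le (1 - X i j) (\<lambda>x. of_bool (x = (i, j)))"
  by (rule degree_le_diff[OF degree_le_1 degree_le_X])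

lemma permute_vars_X:
  assumes "inj \<tau>" and "\<tau> (i', j') = (i, j)"
  shows "permute_vars \<tau> (X i j) = X i' j'"
proof -
  have "permute_monom \<tau> (single (i, j) 1) = single (i', j') 1"
    using assms by (intro poly_mapping_eqI) (auto simp: lookup_single when_def inj_eq simp flip: assms(2))
  then show ?thesis
    unfolding X_def by (subst monomial_hom.hom_single[OF permute_vars_hom[OF assms(1)]]) (simp add: subst_power_hom)
qed

lemma permute_vars_Z:
  assumes "inj \<tau>"
  shows "permute_vars \<tau> Z = Z"
  unfolding Z_def
  by (subst monomial_hom.hom_single[OF permute_vars_hom[OF assms]])
    (simp add: subst_power_1 monomial_hom.\<mu>_0[OF permute_vars_hom[OF assms, of 1]])

text \<open>The swap permutes all pairs \<open>i < j\<close> other than \<open>(a, a + 1)\<close>,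
  whose factor changes its sign.\<close>

lemma vandermonde_adjacent_swap:
  fixes f :: "nat \<Rightarrow> 'a::comm_ring_1"
  assumes a: "a \<in> {1..<v}"
  defines "t \<equiv> transpose a (Suc a)"
  shows "(\<Prod>i\<in>{1..v}. \<Prod>j\<in>{i<..v}. f (t j) - f (t i)) = - (\<Prod>i\<in>{1..v}. \<Prod>j\<in>{i<..v}. f j - f i)"
proof -
  define S where "S = (SIGMA i:{1..v}. {i<..v})"
  define S' where "S' = S - {(a, Suc a)}"
  have S: "S = insert (a, Suc a) S'" "finite S'" "(a, Suc a) \<notin> S'"
    using a by (auto simp: S_def S'_def)
  have "(\<Prod>(i, j)\<in>S'. f (t j) - f (t i)) = (\<Prod>(i, j)\<in>S'. f j - f i)"
    by (rule prod.reindex_bij_witness[where i = "\<lambda>(i, j). (t i, t j)" and j = "\<lambda>(i, j). (t i, t j)"])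
      (use a in \<open>auto simp: t_def S'_def S_def transpose_def split: if_splits\<close>)
  then have "(\<Prod>(i, j)\<in>S. f (t j) - f (t i)) = - (\<Prod>(i, j)\<in>S. f j - f i)"
    using S(2,3) by (simp add: S(1) t_def flip: mult_minus_left)
  then show ?thesis by (simp add: S_def prod.Sigma)
qed

lemma permute_vars_Delta:
  assumes m: "m \<in> {1..n-1}" and a: "a \<in> {1..<vdim k n m}"
  shows "permute_vars (adj m a) (Delta k n) = - Delta k n"
proof -
  interpret perm: monomial_hom "permute_monom (adj m a)" "subst_power (Suc 0)"
    by (rule permute_vars_hom) simp
  define W where "W i = (\<Prod>a\<in>{1..vdim k n i}. \<Prod>b\<in>{a<..vdim k n i}. X i b - X i a)" for i
  let ?t = "transpose a (Suc a)"
  have row: "perm.H (X m j) = X m (?t j)" for j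
    by (rule permute_vars_X) (auto simp: transpose_def)
  have other: "perm.H (X i j) = X i j" if "i \<noteq> m" for i j
    by (rule permute_vars_X) (use that in \<open>auto simp: transpose_def\<close>)
  have "perm.H (W m) = - W m"
    unfolding W_def perm.hom_prod perm.hom_diff row by (rule vandermonde_adjacent_swap[OF a])
  moreover have "perm.H (W i) = W i" if "i \<noteq> m" for i
    unfolding W_def perm.hom_prod perm.hom_diff other[OF that] ..
  moreover have "Delta k n = W m * (\<Prod>i\<in>{1..n-1} - {m}. W i)"
    unfolding Delta_def W_def using m by (intro prod.remove) auto
  ultimately show ?thesis by (simp add: perm.hom_mult perm.hom_prod)
qed

section \<open>The master polynomial\<close>

text \<open>Degrees and exponents of the products are triple sums of indicators. This evaluates the
  part where the variable \<open>(m, j)\<close> is the one indexed by \<open>(i, a)\<close>; in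
  \<open>sum_of_bool_third\<close> its second index is \<open>b\<close>.\<close>

lemma sum_of_bool_second:
  fixes B :: "nat \<Rightarrow> nat \<Rightarrow> nat set"
  assumes "finite I" and "\<And>i. finite (A i)" and "\<And>i a. finite (B i a)"
  shows "(\<Sum>i\<in>I. \<Sum>a\<in>A i. \<Sum>b\<in>B i a. of_bool (i = m \<and> a = j \<and> P i a b))
    = (if m \<in> I \<and> j \<in> A m then card (B m j \<inter> {b. P m j b}) else 0)"
proof -
  have "(\<Sum>b\<in>B m a. of_bool (a = j \<and> P m a b)) = (if a = j then card (B m j \<inter> {b. P m j b}) else 0)" for a
    using assms by (simp add: sum_of_bool_eq)
  then have "(\<Sum>a\<in>A i. \<Sum>b\<in>B i a. of_bool (i = m \<and> a = j \<and> P i a b))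
      = (if i = m then (\<Sum>a\<in>A m. if a = j then card (B m j \<inter> {b. P m j b}) else 0) else 0)" for i
    by (cases "i = m") (simp_all only: simp_thms if_True if_False of_bool_eq sum.neutral_const)
  then show ?thesis using assms by simp
qed

lemma sum_of_bool_third:
  fixes B :: "nat \<Rightarrow> nat \<Rightarrow> nat set"
  assumes "finite I" and "\<And>i. finite (A i)" and "\<And>i a. finite (B i a)"
  shows "(\<Sum>i\<in>I. \<Sum>a\<in>A i. \<Sum>b\<in>B i a. of_bool (i = m \<and> b = j \<and> P i a b))
    = (if m \<in> I then card (A m \<inter> {a. j \<in> B m a \<and> P m a j}) else 0)"
proof -
  have 1: "(\<Sum>b\<in>B m a. of_bool (b = j \<and> P m a b)) = (of_bool (j \<in> B m a \<and> P m a j) :: nat)" for a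
  proof -
    have "(\<Sum>b\<in>B m a. of_bool (b = j \<and> P m a b)) = (\<Sum>b\<in>B m a. if b = j then of_bool (P m a j) else (0 :: nat))"
      by (intro sum.cong) auto
    then show ?thesis using assms by simp
  qed
  have "(\<Sum>a\<in>A i. \<Sum>b\<in>B i a. of_bool (i = m \<and> b = j \<and> P i a b))
      = (if i = m then card (A m \<inter> {a. j \<in> B m a \<and> P m a j}) else 0)" for i
  proof (cases "i = m")
    case True
    then have "(\<Sum>a\<in>A i. \<Sum>b\<in>B i a. of_bool (i = m \<and> b = j \<and> P i a b))
        = (\<Sum>a\<in>A m. of_bool (j \<in> B m a \<and> P m a j) :: nat)"
      by (simp only: 1 simp_thms)
    also have "\<dots> = card (A m \<inter> {a. j \<in> B m a \<and> P m a j})"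
      using assms by (simp add: sum_of_bool_eq)
    finally show ?thesis using True by simp
  qed simp
  then show ?thesis using assms by simp
qed

lemma sum_of_bool_pair:
  fixes A :: "nat \<Rightarrow> nat set"
  assumes "finite I" and "\<And>i. finite (A i)"
  shows "(\<Sum>i\<in>I. \<Sum>a\<in>A i. of_bool (i = m \<and> a = j)) = (of_bool (m \<in> I \<and> j \<in> A m) :: nat)"
  using sum_of_bool_second[OF assms, of "\<lambda>_ _. {0}" m j "\<lambda>_ _ _. True"] by auto

lemma mem_vars: "(m, j) \<in> vars M v \<longleftrightarrow> m \<in> M \<and> j \<in> {1..v m}"
  by (simp add: vars_def)

lemma vdim_le: "k \<le> n \<Longrightarrow> i \<le> n \<Longrightarrow> vdim k n i \<le> n"
  by (simp add: vdim_def)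

lemma card_Int_less: "c \<le> Suc v \<Longrightarrow> card ({1..v} \<inter> {b. b < c}) = c - 1"
proof -
  assume "c \<le> Suc v"
  then have "{1..v} \<inter> {b. b < c} = {1..<c}" by auto
  then show ?thesis by simp
qed

lemma card_Int_le: "c \<le> v \<Longrightarrow> card ({1..v} \<inter> {b. b \<le> c}) = c"
proof -
  assume "c \<le> v"
  then have "{1..v} \<inter> {b. b \<le> c} = {1..c}" by auto
  then show ?thesis by simp
qed

text \<open>The two sides have different parity, as \<open>|i - k|\<close> changes by one.\<close>

lemma e_wt_adjacent_neq: "e_wt k i a \<noteq> e_wt k (i + 1) b"
  unfolding e_wt_def by (cases "i < k") (simp_all, presburger+)

lemma e_wt_up: "e_wt k (m + 1) b < e_wt k m j \<longleftrightarrow> (if m < k then b \<le> j else b < j)"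
  unfolding e_wt_def by auto

lemma e_wt_down: "m \<ge> 1 \<Longrightarrow> e_wt k (m - 1) a < e_wt k m j \<longleftrightarrow> (if m \<le> k then a < j else a \<le> j)"
  unfolding e_wt_def by auto

text \<open>In its row, \<open>X m j\<close> meets \<open>j - 1\<close> variables with smaller and
  \<open>v m - j\<close> with larger index.\<close>

lemma degree_le_Delta: "degree_le (Delta k n) (staircase_box {1..n-1} (vdim k n))"
proof -
  let ?v = "vdim k n"
  have "degree_le (Delta k n) (\<lambda>x. \<Sum>m\<in>{1..n-1}. \<Sum>i\<in>{1..?v m}. \<Sum>j\<in>{i<..?v m}.
      of_bool (x = (m, j)) + of_bool (x = (m, i)))"
    unfolding Delta_def by (intro degree_le_prod degree_le_X_diff)
  moreover have "(\<Sum>m\<in>{1..n-1}. \<Sum>i\<in>{1..?v m}. \<Sum>j\<in>{i<..?v m}. of_bool (x = (m, j)) + of_bool (x = (m, i)))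
      \<le> staircase_box {1..n-1} ?v x" for x
  proof -
    obtain m j where x: "x = (m, j)" by (cases x)
    have "(\<Sum>m'\<in>{1..n-1}. \<Sum>i\<in>{1..?v m'}. \<Sum>j'\<in>{i<..?v m'}. of_bool (x = (m', j')) + of_bool (x = (m', i)))
      = (\<Sum>m'\<in>{1..n-1}. \<Sum>i\<in>{1..?v m'}. \<Sum>j'\<in>{i<..?v m'}. of_bool (m' = m \<and> j' = j \<and> True))
      + (\<Sum>m'\<in>{1..n-1}. \<Sum>i\<in>{1..?v m'}. \<Sum>j'\<in>{i<..?v m'}. of_bool (m' = m \<and> i = j \<and> True))"
      unfolding sum.distrib[symmetric] x by (intro sum.cong) auto
    also have "\<dots> = (if m \<in> {1..n-1} then card ({1..?v m} \<inter> {i. j \<in> {i<..?v m} \<and> True}) else 0)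
      + (if m \<in> {1..n-1} \<and> j \<in> {1..?v m} then card ({j<..?v m} \<inter> {i. True}) else 0)"
      by (rule arg_cong2[where f = plus, OF sum_of_bool_third sum_of_bool_second]) simp_all
    also have "\<dots> \<le> staircase_box {1..n-1} ?v x"
    proof (cases "m \<in> {1..n-1} \<and> j \<in> {1..?v m}")
      case True
      then have "{1..?v m} \<inter> {i. j \<in> {i<..?v m} \<and> True} = {1..<j}" by auto
      with True show ?thesis by (simp add: staircase_box_def x vars_def)
    next
      case False
      then have "m \<in> {1..n-1} \<Longrightarrow> {1..?v m} \<inter> {i. j \<in> {i<..?v m} \<and> True} = {}" by auto
      with False show ?thesis by auto
    qed
    finally show ?thesis .
  qed
  ultimately show ?thesis by (rule degree_le_mono)
qed

section \<open>Symmetry and degree of the concrete master polynomial\<close>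

locale dwork_setup =
  fixes k n r q p l :: nat
  assumes k: "k \<ge> 1" and n: "n \<ge> 2 * k" and q: "q > 0" and rq: "2 * r \<le> q"
    and prime_p: "prime p" and odd_p: "odd p" and p_eq: "p = l * q + 1"
begin

abbreviation "v \<equiv> vdim k n"
abbreviation "M \<equiv> {1..n-1}"
abbreviation "V \<equiv> vars M v"
abbreviation "\<rho> \<equiv> staircase M v"

definition "var_product = (\<Prod>i\<in>{1..n-1}. \<Prod>j\<in>{1..v i}. X i j)"
definition "neighbour_product = (\<Prod>i\<in>{1..n-2}. \<Prod>a\<in>{1..v i}. \<Prod>b\<in>{1..v (i+1)}. X i a - X (i+1) b)"
definition "boundary_product = (\<Prod>i\<in>{1..k}. (Z - X k i) * (1 - X (n-k) i))"

text \<open>\<open>Phi_bar\<close> at \<open>s = 1\<close>, since \<open>(p - 1) div q = l\<close>.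
  The sign of \<open>T_poly\<close> is built in, which makes the initial coefficient 1.\<close>

definition G :: xz_poly where
  "G = (-1) ^ (l * r * sign_count k n) *
    (var_product ^ (l * (q - r)) * Delta k n ^ (l * (q - 2 * r)) * neighbour_product ^ (l * r) * boundary_product ^ (l * r))"

lemma v_k: "v k = k" "v (n - k) = k"
  using k n by (auto simp: vdim_def)

text \<open>From \<open>p ^ s - 1 = repunit p s * l * q\<close>, every exponent, also that of the
  sign, is \<open>repunit p s\<close> times its value at \<open>s = 1\<close>.\<close>

lemma signed_Phi: "(-1) ^ (((p ^ s - 1) * r div q) * sign_count k n) * Phi k n r q p s = Delta k n * G ^ repunit p s"
proof -
  have "p ^ s - 1 = repunit p s * (p - 1)"
    using p_eq by (intro repunit_mult[symmetric]) simp
  then have "p ^ s - 1 = repunit p s * (l * q)" using p_eq by simp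
  then have E: "(p ^ s - 1) * e div q = l * e * repunit p s" for e
    using q by (simp add: ac_simps)
  have "Phi_bar k n r q p s = (var_product ^ (l * (q - r)) * Delta k n ^ (l * (q - 2 * r)) * neighbour_product ^ (l * r) * boundary_product ^ (l * r)) ^ repunit p s"
    unfolding Phi_bar_def E var_product_def neighbour_product_def boundary_product_def by (simp only: power_mult power_mult_distrib)
  moreover have "(-1 :: xz_poly) ^ (((p ^ s - 1) * r div q) * sign_count k n) = ((-1) ^ (l * r * sign_count k n)) ^ repunit p s"
    unfolding E power_mult[symmetric] by (rule arg_cong[where f = "(^) (-1)"]) simp
  ultimately show ?thesis
    unfolding Phi_def G_def by (simp only: power_mult_distrib ac_simps)
qed

lemma frob_lift_G: "frob_lift p G"
proof -
  have X: "frob_lift p (X i j - X i' j')" for i j i' j'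
    using prime_p by (intro frob_lift_diff frob_lift_X)
  have "frob_lift p (Delta k n)" unfolding Delta_def by (intro frob_lift_prod X)
  then show ?thesis
    unfolding G_def var_product_def neighbour_product_def boundary_product_def using prime_p
    by (intro frob_lift_mult frob_lift_power frob_lift_prod frob_lift_uminus frob_lift_1 X
        frob_lift_X frob_lift_diff frob_lift_Z)
qed

lemma G_symmetric:
  assumes m: "m \<in> M" and a: "a \<in> {1..<v m}"
  shows "permute_vars (adj m a) G = G"
proof -
  interpret perm: monomial_hom "permute_monom (adj m a)" "subst_power (Suc 0)"
    by (rule permute_vars_hom) simp
  define t where "t i = (if i = m then transpose a (Suc a) else id)" for i
  have X: "perm.H (X i j) = X i (t i j)" for i j
    by (rule permute_vars_X) (auto simp: t_def transpose_def)
  have Z: "perm.H Z = Z" by (rule permute_vars_Z) simp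
  have bij: "bij_betw (t i) {1..v i} {1..v i}" for i
    using a by (auto simp: t_def bij_betw_transpose_iff)
  have reindex: "(\<Prod>j\<in>{1..v i}. f (t i j)) = (\<Prod>j\<in>{1..v i}. f j)" for i and f :: "nat \<Rightarrow> xz_poly"
    by (rule prod.reindex_bij_betw[OF bij])
  have reindex2: "(\<Prod>a\<in>{1..v i}. \<Prod>b\<in>{1..v i'}. f (t i a) (t i' b)) = (\<Prod>a\<in>{1..v i}. \<Prod>b\<in>{1..v i'}. f a b)"
    for i i' and f :: "nat \<Rightarrow> nat \<Rightarrow> xz_poly"
    using reindex[of "\<lambda>a. \<Prod>b\<in>{1..v i'}. f a b" i] by (simp only: reindex[of "f _" i'])
  have "perm.H var_product = var_product"
    unfolding var_product_def perm.hom_prod X reindex ..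
  moreover have "perm.H neighbour_product = neighbour_product"
    unfolding neighbour_product_def perm.hom_prod perm.hom_diff X by (intro prod.cong refl reindex2)
  moreover have "perm.H boundary_product = boundary_product"
    unfolding boundary_product_def perm.hom_prod perm.hom_diff perm.hom_mult perm.hom_1 Z X prod.distrib
    using reindex[of "\<lambda>j. Z - X k j" k] reindex[of "\<lambda>j. 1 - X (n - k) j" "n - k"]
    by (simp only: v_k)
  \<comment> \<open>\<open>Delta\<close> changes sign under the swap, but its exponent differs from
    the even number \<open>l * q = p - 1\<close> by \<open>2 * l * r\<close>.\<close>
  moreover have "even (l * (q - 2 * r))"
    using odd_p p_eq rq by auto
  then have "perm.H (Delta k n ^ (l * (q - 2 * r))) = Delta k n ^ (l * (q - 2 * r))"
    unfolding perm.hom_power permute_vars_Delta[OF m a] by simp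
  ultimately show ?thesis
    unfolding G_def perm.hom_mult perm.hom_power perm.hom_uminus perm.hom_1 by simp
qed

lemma degree_le_neighbour_product:
  "degree_le neighbour_product (\<lambda>(m, j). if (m, j) \<in> V then (if m \<le> n - 2 then v (m + 1) else 0) + (if m \<ge> 2 then v (m - 1) else 0) else 0)"
proof -
  have "degree_le neighbour_product (\<lambda>x. \<Sum>i\<in>{1..n-2}. \<Sum>a\<in>{1..v i}. \<Sum>b\<in>{1..v (i+1)}. of_bool (x = (i, a)) + of_bool (x = (i + 1, b)))"
    unfolding neighbour_product_def by (intro degree_le_prod degree_le_X_diff)
  moreover have "(\<Sum>i\<in>{1..n-2}. \<Sum>a\<in>{1..v i}. \<Sum>b\<in>{1..v (i+1)}. of_bool (x = (i, a)) + of_bool (x = (i + 1, b)))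
    \<le> (case x of (m, j) \<Rightarrow> if (m, j) \<in> V then (if m \<le> n - 2 then v (m + 1) else 0) + (if m \<ge> 2 then v (m - 1) else 0) else 0)" for x
  proof -
    obtain m j where x: "x = (m, j)" by (cases x)
    have "(\<Sum>i\<in>{1..n-2}. \<Sum>a\<in>{1..v i}. \<Sum>b\<in>{1..v (i+1)}. of_bool (x = (i, a)) + of_bool (x = (i + 1, b)) :: nat)
      = (\<Sum>i\<in>{1..n-2}. \<Sum>a\<in>{1..v i}. \<Sum>b\<in>{1..v (i+1)}. of_bool (i = m \<and> a = j \<and> True))
      + (\<Sum>i\<in>{1..n-2}. \<Sum>a\<in>{1..v i}. \<Sum>b\<in>{1..v (i+1)}. of_bool (i = m - 1 \<and> b = j \<and> m \<ge> 1))"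
      unfolding sum.distrib[symmetric] x
    proof (intro sum.cong refl)
      fix i a b
      have "i + 1 = m \<longleftrightarrow> i = m - 1 \<and> m \<ge> 1" by auto
      then show "of_bool ((m, j) = (i, a)) + of_bool ((m, j) = (i + 1, b))
          = (of_bool (i = m \<and> a = j \<and> True) + of_bool (i = m - 1 \<and> b = j \<and> m \<ge> 1) :: nat)"
        by auto
    qed
    also have "\<dots> = (if m \<in> {1..n-2} \<and> j \<in> {1..v m} then card ({1..v (m+1)} \<inter> {b. True}) else 0)
      + (if m - 1 \<in> {1..n-2} then card ({1..v (m - 1)} \<inter> {a. j \<in> {1..v (m - 1 + 1)} \<and> m \<ge> 1}) else 0)"
      by (rule arg_cong2[where f = plus, OF sum_of_bool_second sum_of_bool_third]) simp_all
    also have "\<dots> \<le> (if (m, j) \<in> V then (if m \<le> n - 2 then v (m + 1) else 0) + (if m \<ge> 2 then v (m - 1) else 0) else 0)"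
      unfolding mem_vars by auto
    finally show ?thesis by (simp only: x case_prod_conv)
  qed
  ultimately show ?thesis by (rule degree_le_mono)
qed

text \<open>Extended by 0 at both ends, \<open>v\<close> is concave with kinks only at
  \<open>k\<close> and \<open>n - k\<close>; the boundary factors sit exactly at these two
  rows.\<close>

lemma vdim_adjacent_sum:
  assumes "m \<in> {1..n-1}"
  shows "(if m \<le> n - 2 then v (m + 1) else 0) + (if m \<ge> 2 then v (m - 1) else 0)
    + (of_bool (m = k) + of_bool (m = n - k)) \<le> 2 * v m"
  using assms k n by (auto simp: vdim_def)

text \<open>With at most \<open>2 * v m\<close> neighbour and boundary factors per variable, the
  degree is at most \<open>l(q - r) + l(q - 2r)(v m - 1) + 2 l r v m = (p - 1) v m + l
  r\<close>.\<close>

lemma degree_le_G: "degree_le G (\<lambda>x. if x \<in> V then (p - 1) * v (fst x) + l * r else 0)"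
proof -
  have var_product: "degree_le var_product (\<lambda>x. of_bool (x \<in> V))"
  proof (rule degree_le_mono)
    show "degree_le var_product (\<lambda>x. \<Sum>i\<in>{1..n-1}. \<Sum>j\<in>{1..v i}. of_bool (x = (i, j)))"
      unfolding var_product_def by (intro degree_le_prod degree_le_X)
    show "(\<Sum>i\<in>{1..n-1}. \<Sum>j\<in>{1..v i}. of_bool (x = (i, j))) \<le> (of_bool (x \<in> V) :: nat)" for x
      using sum_of_bool_pair[of "{1..n-1}" "\<lambda>i. {1..v i}" "fst x" "snd x"]
      by (simp add: vars_def mem_Times_iff prod_eq_iff eq_commute[of "fst x"] eq_commute[of "snd x"] case_prod_beta mem_Sigma_iff[of "fst x" "snd x", simplified])
  qed
  have boundary_product: "degree_le boundary_product (\<lambda>x. if x \<in> V then of_bool (fst x = k) + of_bool (fst x = n - k) else 0)"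
  proof (rule degree_le_mono)
    show "degree_le boundary_product (\<lambda>x. \<Sum>i\<in>{1..k}. of_bool (x = (k, i)) + of_bool (x = (n - k, i)))"
      unfolding boundary_product_def by (intro degree_le_prod degree_le_mult degree_le_Z_diff degree_le_one_diff)
    fix x :: "nat \<times> nat"
    obtain m j where x: "x = (m, j)" by (cases x)
    have "(\<Sum>i\<in>{1..k}. of_bool (x = (c, i))) = (of_bool (m = c \<and> j \<in> {1..k}) :: nat)" for c
      by (cases "m = c") (simp_all add: x of_bool_def)
    then show "(\<Sum>i\<in>{1..k}. of_bool (x = (k, i)) + of_bool (x = (n - k, i)))
        \<le> (if x \<in> V then of_bool (fst x = k) + of_bool (fst x = n - k) else (0 :: nat))"
      using k n v_k by (auto simp: x sum.distrib mem_vars)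
  qed
  have sgn: "degree_le ((-1) ^ e :: xz_poly) (\<lambda>x. 0)" for e
    by (cases "even e") (simp_all add: degree_le_def)
  show ?thesis
  proof (rule degree_le_mono)
    show "degree_le G (\<lambda>x. 0 + (l * (q - r) * of_bool (x \<in> V) + l * (q - 2 * r) * staircase_box M v x
        + l * r * (case x of (m, j) \<Rightarrow> if (m, j) \<in> V then (if m \<le> n - 2 then v (m + 1) else 0) + (if m \<ge> 2 then v (m - 1) else 0) else 0)
        + l * r * (if x \<in> V then of_bool (fst x = k) + of_bool (fst x = n - k) else 0)))"
      unfolding G_def by (intro degree_le_mult degree_le_power sgn var_product boundary_product degree_le_neighbour_product degree_le_Delta)
    fix x :: "nat \<times> nat"
    obtain m j where x: "x = (m, j)" by (cases x)
    let ?c = "(if m \<le> n - 2 then v (m + 1) else 0) + (if m \<ge> 2 then v (m - 1) else 0)"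
    let ?d = "of_bool (m = k) + of_bool (m = n - k) :: nat"
    have "l * (q - r) + l * (q - 2 * r) * (v m - 1) + l * r * ?c + l * r * ?d \<le> (p - 1) * v m + l * r"
      if "(m, j) \<in> V"
    proof -
      have m: "m \<in> {1..n-1}" and "v m \<ge> 1" using that by (auto simp: mem_vars)
      then obtain w where w: "v m = Suc w" by (cases "v m") auto
      obtain u where u: "q = 2 * r + u" using rq by (auto simp: le_iff_add)
      have "l * r * (?c + ?d) \<le> l * r * (2 * v m)"
        using vdim_adjacent_sum[OF m] by (rule mult_le_mono2)
      then have "l * r * ?c + l * r * ?d \<le> l * r * (2 * v m)"
        by (simp only: distrib_left)
      moreover have "l * (q - r) + l * (q - 2 * r) * (v m - 1) + l * r * (2 * v m) = (p - 1) * v m + l * r"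
        by (simp add: p_eq u w algebra_simps)
      ultimately show ?thesis by linarith
    qed
    then show "0 + (l * (q - r) * of_bool (x \<in> V) + l * (q - 2 * r) * staircase_box M v x
        + l * r * (case x of (m, j) \<Rightarrow> if (m, j) \<in> V then (if m \<le> n - 2 then v (m + 1) else 0) + (if m \<ge> 2 then v (m - 1) else 0) else 0)
        + l * r * (if x \<in> V then of_bool (fst x = k) + of_bool (fst x = n - k) else 0))
      \<le> (if x \<in> V then (p - 1) * v (fst x) + l * r else 0)"
      by (cases "(m, j) \<in> V") (simp_all only: x staircase_box_def fst_conv case_prod_conv if_True if_False of_bool_eq add_0 mult_1_right mult_0_right)
  qed
qed

end

section \<open>The initial monomial at z = 0\<close>

context dwork_setup
begin

text \<open>
  The weight \<open>3 n + 1 - e_wt\<close> is positive and orders the variables opposite to \<open>e_wt\<close>. The initial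
  monomial thus takes the variable with larger \<open>e_wt\<close> from each difference and 1 from each \<open>1 - x\<close>.
\<close>

definition wt :: "nat \<times> nat \<Rightarrow> nat" where
  "wt x = nat (3 * int n + 1 - e_wt k (fst x) (snd x))"

lemma k_le_n: "k \<le> n"
  using n by simp

text \<open>For indices up to \<open>n\<close>, \<open>e_wt\<close> is at most
  \<open>3 n - 1\<close>, so the truncation by \<open>nat\<close> in \<open>wt\<close> has no
  effect.\<close>

lemma wt_pos:
  assumes "i \<le> n" "j \<in> {1..v i}"
  shows "wt (i, j) > 0"
  using assms vdim_le[OF k_le_n assms(1)] k_le_n by (auto simp: wt_def e_wt_def)

lemma wt_less:
  assumes "i \<le> n" "j \<in> {1..v i}" "i' \<le> n" "j' \<in> {1..v i'}"
  shows "wt (i', j') < wt (i, j) \<longleftrightarrow> e_wt k i j < e_wt k i' j'"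
  using assms vdim_le[OF k_le_n assms(1)] vdim_le[OF k_le_n assms(3)] k_le_n
  by (auto simp: wt_def e_wt_def)

definition "var_exponent = (\<Sum>i\<in>{1..n-1}. \<Sum>j\<in>{1..v i}. single (i, j) (1 :: nat))"
definition "neighbour_exponent = (\<Sum>i\<in>{1..n-2}. \<Sum>a\<in>{1..v i}. \<Sum>b\<in>{1..v (i+1)}.
  single (if e_wt k i a < e_wt k (i + 1) b then (i + 1, b) else (i, a)) (1 :: nat))"
definition "boundary_exponent = (\<Sum>i\<in>{1..k}. single (k, i) (1 :: nat))"

lemma single_when: "lookup (single x (1 :: nat)) y = of_bool (x = y)"
  by (simp add: lookup_single when_def)

lemma lookup_var_exponent: "lookup var_exponent (m, j) = of_bool ((m, j) \<in> V)"
  unfolding var_exponent_def lookup_sum single_when prod.inject mem_vars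
  by (rule sum_of_bool_pair) simp_all

lemma lookup_boundary_exponent: "lookup boundary_exponent (m, j) = of_bool (m = k \<and> j \<in> {1..k})"
  by (cases "m = k") (auto simp: boundary_exponent_def lookup_sum lookup_single when_def)

lemma Delta_initial_monomial:
  "(\<Sum>m\<in>{1..n-1}. \<Sum>i\<in>{1..v m}. \<Sum>j\<in>{i<..v m}. single (m, j) (1 :: nat)) = \<rho>"
proof (rule poly_mapping_eqI)
  fix x :: "nat \<times> nat"
  obtain m j where x: "x = (m, j)" by (cases x)
  have "(\<Sum>i\<in>{1..n-1}. \<Sum>a\<in>{1..v i}. \<Sum>b\<in>{a<..v i}. of_bool (i = m \<and> b = j))
      = (\<Sum>i\<in>{1..n-1}. \<Sum>a\<in>{1..v i}. \<Sum>b\<in>{a<..v i}. of_bool (i = m \<and> b = j \<and> True) :: nat)"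
    by simp
  also have "\<dots> = (if m \<in> {1..n-1} then card ({1..v m} \<inter> {a. j \<in> {a<..v m} \<and> True}) else 0)"
    by (rule sum_of_bool_third) auto
  also have "\<dots> = (if (m, j) \<in> V then j - 1 else 0)"
  proof (cases "(m, j) \<in> V")
    case True
    then have "{1..v m} \<inter> {a. j \<in> {a<..v m} \<and> True} = {1..<j}" by (auto simp: mem_vars)
    then show ?thesis using True by (simp add: mem_vars)
  next
    case False
    then have "m \<in> {1..n-1} \<Longrightarrow> {1..v m} \<inter> {a. j \<in> {a<..v m} \<and> True} = {}" by (auto simp: mem_vars)
    then show ?thesis using False by auto
  qed
  finally show "lookup (\<Sum>m\<in>{1..n-1}. \<Sum>i\<in>{1..v m}. \<Sum>j\<in>{i<..v m}. single (m, j) (1 :: nat)) x = lookup \<rho> x"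
    unfolding x lookup_sum single_when prod.inject by (simp add: lookup_staircase)
qed

text \<open>The variable \<open>(m, j)\<close> is selected from \<open>j\<close> differences with
  one neighbouring row and \<open>j - 1\<close> with the other, except for \<open>m = k\<close>,
  where both counts are \<open>j - 1\<close>. The missing one is supplied by
  \<open>Z - X k j\<close>.\<close>

lemma lookup_neighbour_exponent:
  "lookup neighbour_exponent (m, j) + of_bool (m = k \<and> j \<in> {1..k}) = (if (m, j) \<in> V then 2 * j - 1 else 0)"
proof -
  let ?lt = "\<lambda>i a b. e_wt k i a < e_wt k (i + 1) b"
  let ?L = "if m \<in> {1..n-2} \<and> j \<in> {1..v m} then card ({1..v (m+1)} \<inter> {b. \<not> ?lt m j b}) else 0"
  let ?R = "if m - 1 \<in> {1..n-2} then card ({1..v (m - 1)} \<inter> {a. j \<in> {1..v (m - 1 + 1)} \<and> m \<ge> 1 \<and> ?lt (m - 1) a j}) else 0"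
  have "lookup neighbour_exponent (m, j) = (\<Sum>i\<in>{1..n-2}. \<Sum>a\<in>{1..v i}. \<Sum>b\<in>{1..v (i+1)}.
      of_bool ((if ?lt i a b then (i + 1, b) else (i, a)) = (m, j)))"
    unfolding neighbour_exponent_def lookup_sum single_when by (rule refl)
  also have "\<dots> = (\<Sum>i\<in>{1..n-2}. \<Sum>a\<in>{1..v i}. \<Sum>b\<in>{1..v (i+1)}. of_bool (i = m \<and> a = j \<and> \<not> ?lt i a b))
      + (\<Sum>i\<in>{1..n-2}. \<Sum>a\<in>{1..v i}. \<Sum>b\<in>{1..v (i+1)}. of_bool (i = m - 1 \<and> b = j \<and> m \<ge> 1 \<and> ?lt i a b))"
    unfolding sum.distrib[symmetric]
  proof (intro sum.cong refl)
    fix i a b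
    have "i + 1 = m \<longleftrightarrow> i = m - 1 \<and> m \<ge> 1" by auto
    then show "of_bool ((if ?lt i a b then (i + 1, b) else (i, a)) = (m, j))
        = (of_bool (i = m \<and> a = j \<and> \<not> ?lt i a b) + of_bool (i = m - 1 \<and> b = j \<and> m \<ge> 1 \<and> ?lt i a b) :: nat)"
      by (cases "?lt i a b") auto
  qed
  also have "\<dots> = ?L
      + ?R"
    by (rule arg_cong2[where f = plus, OF sum_of_bool_second sum_of_bool_third]) simp_all
  finally have neighbour_exponent: "lookup neighbour_exponent (m, j) = ?L + ?R" .
  have "?L + ?R + of_bool (m = k \<and> j \<in> {1..k}) = (if (m, j) \<in> V then 2 * j - 1 else 0)"
  proof (cases "(m, j) \<in> V")
    case True
    then have m: "1 \<le> m" "m \<le> n - 1" and j: "1 \<le> j" "j \<le> v m" by (auto simp: mem_vars)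
    have L: "?L = (if m < k then j else j - 1)"
    proof (cases "m \<le> n - 2")
      case le: True
      have "\<not> ?lt m j b \<longleftrightarrow> (if m < k then b \<le> j else b < j)" for b
        using e_wt_adjacent_neq[of k m j b] e_wt_up[of k m b j] by auto
      moreover have "m < k \<Longrightarrow> j \<le> v (m + 1)" "j \<le> Suc (v (m + 1))"
        using j m k n by (auto simp: vdim_def split: if_splits)
      ultimately show ?thesis
        using le m j card_Int_le[of j "v (m + 1)"] card_Int_less[of j "v (m + 1)"] by simp
    next
      case False
      \<comment> \<open>The last row has no successor, but it consists of one variable, so the
        required count \<open>j - 1\<close> is 0.\<close>
      then have "m = n - 1" using m by simp
      then have "m \<ge> k" "j \<le> 1" using j k n by (auto simp: vdim_def split: if_splits)
      then show ?thesis using False j by simp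
    qed
    have R: "?R
        = (if m \<le> k then j - 1 else j)"
    proof (cases "m \<ge> 2")
      case ge: True
      have "(j \<in> {1..v (m - 1 + 1)} \<and> m \<ge> 1 \<and> ?lt (m - 1) a j) \<longleftrightarrow> (if m \<le> k then a < j else a \<le> j)" for a
        using m j e_wt_down[of m k a j] by simp
      moreover have "m > k \<Longrightarrow> j \<le> v (m - 1)" "j \<le> Suc (v (m - 1))"
        using j m k n by (auto simp: vdim_def split: if_splits)
      moreover have "m - 1 \<in> {1..n-2}" using ge m by auto
      ultimately show ?thesis
        using card_Int_le[of j "v (m - 1)"] card_Int_less[of j "v (m - 1)"] by simp
    next
      case False
      \<comment> \<open>Likewise the first row has no predecessor and only the variable with
        \<open>j = 1\<close>.\<close>
      then have "m = 1" using m by simp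
      then have "m \<le> k" "j \<le> 1" using j k n by (auto simp: vdim_def split: if_splits)
      then show ?thesis using False by simp
    qed
    have "(if m < k then j else j - 1) + (if m \<le> k then j - 1 else j) + of_bool (m = k \<and> j \<in> {1..k}) = 2 * j - 1"
      using j v_k(1) by (cases "m = k") auto
    then show ?thesis by (simp only: L R True if_True)
  next
    case False
    have "\<not> (m = k \<and> j \<in> {1..k})" using False k n v_k(1) by (auto simp: mem_vars)
    moreover have "\<not> (m \<in> {1..n-2} \<and> j \<in> {1..v m})" using False by (auto simp: mem_vars)
    moreover have "{1..v (m - 1)} \<inter> {a. j \<in> {1..v (m - 1 + 1)} \<and> m \<ge> 1 \<and> ?lt (m - 1) a j} = {}" if "m - 1 \<in> {1..n-2}"
      using False that by (auto simp: mem_vars)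
    ultimately show ?thesis using False by auto
  qed
  then show ?thesis unfolding neighbour_exponent .
qed

lemma Delta_initial: "has_initial wt (Delta k n) \<rho> 1"
proof -
  have "has_initial wt (Delta k n) (\<Sum>m\<in>{1..n-1}. \<Sum>i\<in>{1..v m}. \<Sum>j\<in>{i<..v m}. single (m, j) 1)
      (\<Prod>m\<in>{1..n-1}. \<Prod>i\<in>{1..v m}. \<Prod>j\<in>{i<..v m}. 1)"
    unfolding Delta_def
  proof (intro has_initial_prod)
    fix m i j assume "m \<in> {1..n-1}" "i \<in> {1..v m}" "j \<in> {i<..v m}"
    then have "wt (m, j) < wt (m, i)"
      by (subst wt_less) (auto simp: e_wt_def)
    then show "has_initial wt (X m j - X m i) (single (m, j) 1) 1"
      using has_initial_X_diff[of wt m j m i] by simp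
  qed
  then show ?thesis by (simp add: Delta_initial_monomial[simplified])
qed

lemma sign_count_eq:
  "sign_count k n = k + (\<Sum>i\<in>{1..n-2}. \<Sum>a\<in>{1..v i}. card {b\<in>{1..v (i+1)}. e_wt k i a < e_wt k (i + 1) b})"
proof -
  have "{(i, a, b). 1 \<le> i \<and> i \<le> n - 2 \<and> 1 \<le> a \<and> a \<le> v i \<and> 1 \<le> b \<and> b \<le> v (i + 1) \<and> e_wt k i a < e_wt k (i + 1) b}
      = (SIGMA i:{1..n-2}. SIGMA a:{1..v i}. {b\<in>{1..v (i+1)}. e_wt k i a < e_wt k (i + 1) b})"
    by auto
  then show ?thesis by (simp add: sign_count_def)
qed

lemma prod_if_minus_one: "finite B \<Longrightarrow> (\<Prod>b\<in>B. if P b then - 1 else (1 :: int)) = (-1) ^ card {b\<in>B. P b}"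
  by (simp add: prod.If_cases Int_def conj_commute)

text \<open>The exponents add up to
  \<open>l(q - r) + l(q - 2r)(j - 1) + l r (2j - 1) = (p - 1) j\<close>. The signs from neighbour
  and boundary factors combine to \<open>(-1) ^ sign_count k n\<close> to the power
  \<open>l r\<close>, which the prefactor of \<open>G\<close> cancels.\<close>

lemma G_initial: "has_initial wt G (\<Sum>x\<in>V. single x ((p - 1) * snd x)) 1"
proof -
  let ?e = "l * r * sign_count k n"
  have var_product: "has_initial wt var_product var_exponent (\<Prod>i\<in>{1..n-1}. \<Prod>j\<in>{1..v i}. 1)"
    unfolding var_product_def var_exponent_def by (intro has_initial_prod has_initial_X)
  have neighbour_product: "has_initial wt neighbour_product neighbour_exponent
      (\<Prod>i\<in>{1..n-2}. \<Prod>a\<in>{1..v i}. \<Prod>b\<in>{1..v (i+1)}. if e_wt k i a < e_wt k (i + 1) b then -1 else 1)"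
    unfolding neighbour_product_def neighbour_exponent_def
  proof (intro has_initial_prod)
    fix i a b assume i: "i \<in> {1..n-2}" and a: "a \<in> {1..v i}" and b: "b \<in> {1..v (i+1)}"
    have le: "i \<le> n" "i + 1 \<le> n" using i by auto
    have lt: "wt (i + 1, b) < wt (i, a) \<longleftrightarrow> e_wt k i a < e_wt k (i + 1) b"
        "wt (i, a) < wt (i + 1, b) \<longleftrightarrow> e_wt k (i + 1) b < e_wt k i a"
      by (rule wt_less[OF le(1) a le(2) b], rule wt_less[OF le(2) b le(1) a])
    then have "wt (i, a) \<noteq> wt (i + 1, b)"
      using e_wt_adjacent_neq[of k i a b] by (metis less_irrefl linorder_neq_iff)
    then show "has_initial wt (X i a - X (i + 1) b)
        (single (if e_wt k i a < e_wt k (i + 1) b then (i + 1, b) else (i, a)) 1)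
        (if e_wt k i a < e_wt k (i + 1) b then -1 else 1)"
      unfolding lt(1)[symmetric] by (rule has_initial_X_diff)
  qed
  have boundary_product: "has_initial wt boundary_product (\<Sum>i\<in>{1..k}. single (k, i) 1 + 0) (\<Prod>i\<in>{1..k}. (-1) * 1)"
    unfolding boundary_product_def
    by (intro has_initial_prod has_initial_mult has_initial_Z_diff has_initial_one_diff wt_pos)
      (use v_k in simp_all)
  have m1: "has_initial wt (-1 :: xz_poly) 0 (-1)"
    unfolding has_initial_def at_zero.hom_uminus at_zero.hom_1 by (simp add: single_uminus)
  define a where "a = scale_monom ?e 0 + (scale_monom (l * (q - r)) var_exponent + scale_monom (l * (q - 2 * r)) \<rho>
    + scale_monom (l * r) neighbour_exponent + scale_monom (l * r) (\<Sum>i\<in>{1..k}. single (k, i) 1 + 0))"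
  define c :: int where "c = (-1) ^ ?e * ((\<Prod>i\<in>{1..n-1}. \<Prod>j\<in>{1..v i}. 1) ^ (l * (q - r)) * 1 ^ (l * (q - 2 * r))
    * (\<Prod>i\<in>{1..n-2}. \<Prod>a\<in>{1..v i}. \<Prod>b\<in>{1..v (i+1)}. if e_wt k i a < e_wt k (i + 1) b then -1 else 1) ^ (l * r)
    * (\<Prod>i\<in>{1..k}. (-1) * 1) ^ (l * r))"
  have "has_initial wt G a c"
    unfolding G_def a_def c_def by (intro has_initial_mult has_initial_power m1 var_product neighbour_product boundary_product Delta_initial)
  moreover have "c = 1"
  proof -
    let ?N = "\<Sum>i\<in>{1..n-2}. \<Sum>a\<in>{1..v i}. card {b\<in>{1..v (i+1)}. e_wt k i a < e_wt k (i + 1) b}"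
    have "(\<Prod>i\<in>{1..n-2}. \<Prod>a\<in>{1..v i}. \<Prod>b\<in>{1..v (i+1)}. if e_wt k i a < e_wt k (i + 1) b then -1 else (1 :: int)) = (-1) ^ ?N"
      by (simp add: prod_if_minus_one power_sum)
    then have "c = (-1) ^ ?e * (((-1) ^ ?N) ^ (l * r) * ((-1) ^ k) ^ (l * r))"
      unfolding c_def by simp
    also have "\<dots> = (-1) ^ ?e * (-1) ^ ((k + ?N) * (l * r))"
      by (simp only: power_mult[symmetric] power_add[symmetric] distrib_right add_ac)
    also have "(k + ?N) * (l * r) = ?e"
      by (simp only: sign_count_eq mult_ac)
    finally show ?thesis by (simp flip: power_mult_distrib)
  qed
  moreover have "a = (\<Sum>x\<in>V. single x ((p - 1) * snd x))"
  proof (rule poly_mapping_eqI)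
    fix x :: "nat \<times> nat"
    obtain m j where x: "x = (m, j)" by (cases x)
    have rhs: "lookup (\<Sum>x\<in>V. single x ((p - 1) * snd x)) x = (if x \<in> V then (p - 1) * snd x else 0)"
      by (simp add: lookup_sum lookup_single when_def finite_vars)
    have "lookup a x = l * (q - r) * lookup var_exponent (m, j) + l * (q - 2 * r) * lookup \<rho> (m, j)
        + l * r * (lookup neighbour_exponent (m, j) + lookup boundary_exponent (m, j))"
      unfolding a_def boundary_exponent_def by (simp add: lookup_add x distrib_left)
    also have "\<dots> = l * (q - r) * of_bool ((m, j) \<in> V) + l * (q - 2 * r) * (if (m, j) \<in> V then j - 1 else 0)
        + l * r * (if (m, j) \<in> V then 2 * j - 1 else 0)"
      by (simp only: lookup_var_exponent lookup_boundary_exponent lookup_neighbour_exponent lookup_staircase finite_atLeastAtMost snd_conv)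
    also have "\<dots> = (if (m, j) \<in> V then (p - 1) * j else 0)"
    proof (cases "(m, j) \<in> V")
      case True
      then obtain j' where j: "j = Suc j'" by (cases j) (auto simp: mem_vars)
      obtain u where u: "q = 2 * r + u" using rq by (auto simp: le_iff_add)
      have "l * (q - r) + l * (q - 2 * r) * (j - 1) + l * r * (2 * j - 1) = (p - 1) * j"
        by (simp add: p_eq u j algebra_simps)
      then show ?thesis using True by simp
    qed simp
    finally show "lookup a x = lookup (\<Sum>x\<in>V. single x ((p - 1) * snd x)) x"
      unfolding rhs by (simp only: x snd_conv)
  qed
  ultimately show ?thesis by simp
qed

section \<open>Identification with the polynomials of the theorem\<close>

text \<open>Both sides have exponent \<open>j p^s - 1\<close> at \<open>(m, j)\<close>. So the
  coefficient that defines \<open>T\<close> is the one of the initial monomial.\<close>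

lemma cartier_monom_staircase:
  "cartier_monom V (p ^ s) \<rho> = \<rho> + scale_monom (repunit p s) (\<Sum>x\<in>V. single x ((p - 1) * snd x))"
proof (rule poly_mapping_eqI)
  fix x :: "nat \<times> nat"
  obtain m j where x: "x = (m, j)" by (cases x)
  show "lookup (cartier_monom V (p ^ s) \<rho>) x
      = lookup (\<rho> + scale_monom (repunit p s) (\<Sum>x\<in>V. single x ((p - 1) * snd x))) x"
  proof (cases "x \<in> V")
    case True
    then obtain j' where j: "j = Suc j'" by (cases j) (auto simp: x mem_vars)
    have r: "repunit p s * (p - 1) = p ^ s - 1" using p_eq by (intro repunit_mult) simp
    obtain Q where Q: "p ^ s = Suc Q" using p_eq by (cases "p ^ s") auto
    have "lookup (cartier_monom V (p ^ s) \<rho>) x = p ^ s * (j - 1) + (p ^ s - 1)"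
      using True by (simp add: lookup_cartier_monom finite_vars lookup_staircase x)
    also have "\<dots> = (j - 1) + (p ^ s - 1) * j"
      by (simp add: Q j)
    also have "\<dots> = (j - 1) + repunit p s * ((p - 1) * j)"
      by (simp only: r[symmetric] mult.assoc)
    also have "\<dots> = lookup (\<rho> + scale_monom (repunit p s) (\<Sum>x\<in>V. single x ((p - 1) * snd x))) x"
      using True by (simp add: lookup_add lookup_staircase lookup_sum lookup_single when_def finite_vars x)
    finally show ?thesis .
  next
    case False
    then show ?thesis
      by (simp add: lookup_cartier_monom lookup_add lookup_staircase lookup_sum lookup_single when_def finite_vars)
  qed
qed

lemma target_monomial_eq: "target_monomial k n p s = cartier_monom V (p ^ s) \<rho>"
proof (rule poly_mapping_eqI)
  fix x :: "nat \<times> nat"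
  have q: "p ^ s > 0" using p_eq by simp
  have "target_monomial k n p s = (\<Sum>x\<in>V. single x (snd x * p ^ s - 1))"
    by (simp add: target_monomial_def vars_def sum.Sigma case_prod_beta)
  then have "lookup (target_monomial k n p s) x = (if x \<in> V then snd x * p ^ s - 1 else 0)"
    by (simp add: lookup_sum lookup_single when_def finite_vars)
  also have "\<dots> = lookup (cartier_monom V (p ^ s) \<rho>) x"
  proof (cases "x \<in> V")
    case True
    then obtain j where "snd x = Suc j" by (cases "snd x") (auto simp: vars_def)
    moreover obtain Q where "p ^ s = Suc Q" using q by (cases "p ^ s") auto
    ultimately show ?thesis using True by (simp add: lookup_cartier_monom finite_vars lookup_staircase)
  qed (simp add: lookup_cartier_monom finite_vars lookup_staircase)
  finally show "lookup (target_monomial k n p s) x = lookup (cartier_monom V (p ^ s) \<rho>) x" .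
qed

text \<open>The initial term only gives the value at \<open>z = 0\<close>. Invariance under
  \<open>subst_power 0\<close>, which evaluates at \<open>z = 1\<close>, shows that the coefficient
  is constant.\<close>

lemma lookup_Delta_staircase: "lookup (Delta k n) \<rho> = 1"
proof -
  define f where "f = lookup (Delta k n) \<rho>"
  have "pcompose h [:c:] = [:poly h c:]" for h :: "int poly" and c
    by (induction h) (simp_all add: pcompose_pCons)
  then have "subst_power 0 f = [:poly f 1:]"
    by (simp add: subst_power_def monom_0)
  moreover have "f = subst_power 0 f"
    unfolding f_def using lookup_frob_1[of 0 "Delta k n" \<rho>] by (simp only: frob_1_Delta)
  ultimately obtain c where "f = [:c:]" by metis
  moreover have "poly f 0 = 1"
    unfolding f_def by (rule has_initial_lookup[OF Delta_initial])
  ultimately show ?thesis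
    unfolding f_def by (simp add: one_pCons)
qed

sublocale master: symmetric_master M v "Delta k n" G p "l * r"
proof
  show "l * r < p" using rq q p_eq by (simp add: less_Suc_eq_le)
  show "permute_vars (adj m a) (Delta k n) = - Delta k n" if "m \<in> M" "a \<in> {1..<v m}" for m a
    using that by (rule permute_vars_Delta)
  show "permute_vars (adj m a) G = G" if "m \<in> M" "a \<in> {1..<v m}" for m a
    using that by (rule G_symmetric)
qed (fact prime_p degree_le_Delta lookup_Delta_staircase frob_1_Delta degree_le_G frob_lift_G finite_atLeastAtMost)+

lemma T_lookup: "master.T s = lookup (Delta k n * G ^ repunit p s) (cartier_monom V (p ^ s) \<rho>)"
  unfolding master.T_def using master.p_pos by (intro lookup_cartier finite_vars) simp_all

lemma T_at_zero: "poly (master.T s) 0 = 1"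
proof -
  have "has_initial wt (Delta k n * G ^ repunit p s)
      (\<rho> + scale_monom (repunit p s) (\<Sum>x\<in>V. single x ((p - 1) * snd x))) (1 * 1 ^ repunit p s)"
    by (intro has_initial_mult has_initial_power Delta_initial G_initial)
  from has_initial_lookup[OF this] show ?thesis
    by (simp only: T_lookup cartier_monom_staircase mult_1 power_one)
qed

lemma T_poly_eq: "T_poly k n r q p s = master.T s"
proof (cases "s = 0")
  case True
  have "cartier_monom V 1 \<rho> = \<rho>"
    by (rule poly_mapping_eqI) (simp add: lookup_cartier_monom finite_vars)
  then have "master.T 0 = 1"
    by (simp only: T_lookup power_0 repunit_0 mult_1_right lookup_Delta_staircase)
  then show ?thesis using True by (simp add: T_poly_def)
next
  case False
  let ?e = "((p ^ s - 1) * r div q) * sign_count k n"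
  have "(-1 :: xz_poly) ^ ?e = single 0 ((-1) ^ ?e)"
    by (cases "even ?e") (simp_all add: single_uminus)
  then have "lookup (Delta k n * G ^ repunit p s) (target_monomial k n p s)
      = (-1) ^ ?e * lookup (Phi k n r q p s) (target_monomial k n p s)"
    by (simp only: signed_Phi[symmetric] lookup_coeff_mult)
  then show ?thesis
    using False by (simp only: T_poly_def T_lookup target_monomial_eq if_False)
qed

end

theorem theorem1p1:
  fixes k n r q p l :: nat
  assumes "k \<ge> 1" and "n \<ge> 2 * k"
    and "r > 0" and "q > 0" and "real r / real q \<le> 1 / 2"
    and "prime p" and "odd p" and "l > 0" and "p = l * q + 1"
  shows "(\<forall>s. poly (T_poly k n r q p s) 0 = 1) \<and>
    (\<forall>s\<ge>1. fps_cong
       (quot_fps (T_poly k n r q p (s + 1)) (subst_power p (T_poly k n r q p s)))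
       (quot_fps (T_poly k n r q p s) (subst_power p (T_poly k n r q p (s - 1))))
       (int p ^ s))"
proof -
  have "2 * r \<le> q" using assms(4,5) by (simp add: field_simps)
  with assms interpret dwork_setup k n r q p l by unfold_locales
  show ?thesis unfolding T_poly_eq using T_at_zero master.T_dwork by simp
qed

end
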